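(* Let $\omega$ be a nonempty open bounded subset of $\mathbb{R}^2$ and let $\mathbf{B}=(B_1,B_2,B_3)^{T}\in\mathbb{R}^3$ be a constant magnetic field. Define, for $k=0,1,2$, the normalized moments (where $|\omega|$ is the Lebesgue measure of $\omega$) $$m_{k}:=\frac{1}{|\omega|}\int_{\omega}x_1^{k}x_2^{2-k}\,dx_1\,dx_2 .$$ Then for every integer $n\ge 1$ the $n$-th Rayleigh quotient satisfies $$E_n(\mathbf{B},\mathcal{C}_\omega)\le (4n-1)\,e(\mathbf{B},\omega),$$ where $e(\mathbf{B},\omega)$ is the constant (positive when $\mathbf{B}\neq 0$) defined by $$e(\mathbf{B},\omega)=\left(B_3^2\,\frac{m_0m_2-m_1^2}{m_0+m_2}+B_2^2m_2+B_1^2m_0-2B_1B_2m_1\right)^{1/2}.$$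
   Context: For an open bounded set $\omega\subset\mathbb{R}^2$, the cone $\mathcal{C}_\omega$ is $$\mathcal{C}_\omega=\{(x_1,x_2,x_3)\in\mathbb{R}^3:\ x_3>0,\ (x_1/x_3,\,x_2/x_3)\in\omega\}.$$ Let $\mathbf{A}:\mathbb{R}^3\to\mathbb{R}^3$ be a linear magnetic potential with $\operatorname{curl}\mathbf{A}=\mathbf{B}$. Consider the quadratic form $$q[\mathbf{A},\mathcal{C}_\omega](u)=\int_{\mathcal{C}_\omega}|(-i\nabla+\mathbf{A})u|^2\,d\mathbf{x},$$ $$\operatorname{Dom}(q[\mathbf{A},\mathcal{C}_\omega])=\{u\in L^2(\mathcal{C}_\omega):\ (-i\nabla+\mathbf{A})u\in L^2(\mathcal{C}_\omega)\}$$ (complex-valued functions). For $n\ge1$, the $n$-th Rayleigh quotient is $$E_n(\mathbf{B},\mathcal{C}_\omega)=\sup_{u_1,\dots,u_{n-1}\in\operatorname{Dom}(q)}\ \inf_{\substack{u\in[u_1,\dots,u_{n-1}]^\perp\\ u\in\operatorname{Dom}(q),\ u\ne0}}\frac{q[\mathbf{A},\mathcal{C}_\omega](u)}{\|u\|^2_{L^2(\mathcal{C}_\omega)}},$$ where $q=q[\mathbf{A},\mathcal{C}_\omega]$ and $\perp$ denotes orthogonality in $L^2(\mathcal{C}_\omega)$. By gauge invariance it depends only on $\mathbf{B}$ and not on the choice of the linear potential $\mathbf{A}$. *)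

theory Defs
  imports "HOL-Analysis.Analysis"
begin

definition cone_over :: "(real^2) set \<Rightarrow> (real^3) set" where
  "cone_over \<omega> = {x. x$3 > 0 \<and> vector [x$1 / x$3, x$2 / x$3] \<in> \<omega>}"

definition partial :: "'n \<Rightarrow> (real^'n \<Rightarrow> 'b::real_normed_vector) \<Rightarrow> real^'n \<Rightarrow> 'b" where
  "partial i f x = frechet_derivative f (at x) (axis i 1)"

definition curl :: "(real^3 \<Rightarrow> real^3) \<Rightarrow> real^3 \<Rightarrow> real^3" where
  "curl A x = vector
     [partial 2 (\<lambda>y. A y $ 3) x - partial 3 (\<lambda>y. A y $ 2) x,
      partial 3 (\<lambda>y. A y $ 1) x - partial 1 (\<lambda>y. A y $ 3) x,
      partial 1 (\<lambda>y. A y $ 2) x - partial 2 (\<lambda>y. A y $ 1) x]"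

fun Ck :: "nat \<Rightarrow> (real^'n \<Rightarrow> 'b::real_normed_vector) \<Rightarrow> bool" where
  "Ck 0 f \<longleftrightarrow> continuous_on UNIV f"
| "Ck (Suc k) f \<longleftrightarrow> (\<forall>x. f differentiable at x) \<and> (\<forall>i. Ck k (partial i f))"

definition test_functions :: "(real^'n) set \<Rightarrow> (real^'n \<Rightarrow> complex) set" where
  "test_functions \<Omega> =
     {\<phi>. (\<forall>k. Ck k \<phi>) \<and> compact (closure {x. \<phi> x \<noteq> 0}) \<and> closure {x. \<phi> x \<noteq> 0} \<subseteq> \<Omega>}"

text \<open>Elements of $L^2$ are represented by functions, not by classes modulo null sets;
  only the values on the set matter.\<close>

definition L2 :: "'a::euclidean_space set \<Rightarrow> ('a \<Rightarrow> 'b::euclidean_space) set" where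
  "L2 \<Omega> = {u \<in> borel_measurable (lebesgue_on \<Omega>).
            integrable (lebesgue_on \<Omega>) (\<lambda>x. (norm (u x))\<^sup>2)}"

definition L2_inner :: "'a::euclidean_space set \<Rightarrow> ('a \<Rightarrow> complex) \<Rightarrow> ('a \<Rightarrow> complex) \<Rightarrow> complex" where
  "L2_inner \<Omega> u w = (LINT x|lebesgue_on \<Omega>. u x * cnj (w x))"

definition L2_normsq :: "'a::euclidean_space set \<Rightarrow> ('a \<Rightarrow> 'b::euclidean_space) \<Rightarrow> real" where
  "L2_normsq \<Omega> u = (LINT x|lebesgue_on \<Omega>. (norm (u x))\<^sup>2)"

text \<open>The identity $(-i\nabla + A)u = v$ in the sense of distributions on \<open>\<Omega>\<close>:
  each component is paired bilinearly with a test function \<open>\<phi>\<close>, and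
  $\langle -i\partial_j u, \phi\rangle = i \int u\,\partial_j\phi$.\<close>

definition is_magnetic_gradient ::
  "(real^3 \<Rightarrow> real^3) \<Rightarrow> (real^3) set \<Rightarrow> (real^3 \<Rightarrow> complex) \<Rightarrow> (real^3 \<Rightarrow> complex^3) \<Rightarrow> bool" where
  "is_magnetic_gradient A \<Omega> u v \<longleftrightarrow>
     (\<forall>\<phi>\<in>test_functions \<Omega>. \<forall>j.
        (LINT x|lebesgue_on \<Omega>. v x $ j * \<phi> x) =
        (LINT x|lebesgue_on \<Omega>. u x * (\<i> * partial j \<phi> x + of_real (A x $ j) * \<phi> x)))"

definition Dom_q :: "(real^3 \<Rightarrow> real^3) \<Rightarrow> (real^3) set \<Rightarrow> (real^3 \<Rightarrow> complex) set" where
  "Dom_q A \<Omega> = {u \<in> L2 \<Omega>. \<exists>v\<in>L2 \<Omega>. is_magnetic_gradient A \<Omega> u v}"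

text \<open>On an open set a locally integrable function is determined almost everywhere by its
  distribution, so the choice below is unique up to a null set.\<close>

definition magnetic_gradient ::
  "(real^3 \<Rightarrow> real^3) \<Rightarrow> (real^3) set \<Rightarrow> (real^3 \<Rightarrow> complex) \<Rightarrow> real^3 \<Rightarrow> complex^3" where
  "magnetic_gradient A \<Omega> u = (SOME v. v \<in> L2 \<Omega> \<and> is_magnetic_gradient A \<Omega> u v)"

definition magnetic_form :: "(real^3 \<Rightarrow> real^3) \<Rightarrow> (real^3) set \<Rightarrow> (real^3 \<Rightarrow> complex) \<Rightarrow> real" where
  "magnetic_form A \<Omega> u = L2_normsq \<Omega> (magnetic_gradient A \<Omega> u)"

text \<open>Supremum and infimum are taken in the extended reals. The condition $u \neq 0$ is meant
  in $L^2$, i.e. \<open>u\<close> is not almost everywhere zero.\<close>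

definition rayleigh_quotient :: "nat \<Rightarrow> (real^3 \<Rightarrow> real^3) \<Rightarrow> (real^3) set \<Rightarrow> ereal" where
  "rayleigh_quotient n A \<Omega> =
     (SUP us \<in> {us :: nat \<Rightarrow> real^3 \<Rightarrow> complex. \<forall>i\<in>{1..<n}. us i \<in> Dom_q A \<Omega>}.
      INF u \<in> {u \<in> Dom_q A \<Omega>. \<not> (AE x in lebesgue_on \<Omega>. u x = 0) \<and>
                               (\<forall>i\<in>{1..<n}. L2_inner \<Omega> u (us i) = 0)}.
        ereal (magnetic_form A \<Omega> u / L2_normsq \<Omega> u))"

definition moment :: "(real^2) set \<Rightarrow> nat \<Rightarrow> real" where
  "moment \<omega> k =
     (1 / measure lebesgue \<omega>) * (LINT x|lebesgue_on \<omega>. (x$1) ^ k * (x$2) ^ (2 - k))"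

definition e_const :: "real^3 \<Rightarrow> (real^2) set \<Rightarrow> real" where
  "e_const B \<omega> =
     (let m0 = moment \<omega> 0; m1 = moment \<omega> 1; m2 = moment \<omega> 2 in
      sqrt ((B$3)\<^sup>2 * ((m0 * m2 - m1\<^sup>2) / (m0 + m2)) + (B$2)\<^sup>2 * m2 + (B$1)\<^sup>2 * m0
            - 2 * (B$1) * (B$2) * m1))"

end

theory Submission
  imports Defs "HOL-Probability.Distributions"
begin

text \<open>
  Take trial functions $u(x) = e^{i\theta(x)} p(x_3^2) e^{-c x_3^2/2}$ with a complex polynomial \<open>p\<close> of degree
  less than \<open>n\<close>, where the quadratic phase \<open>\<theta>\<close> replaces the given potential by a linear potential \<open>a\<close> with the
  same curl. In the coordinates $(x_3, x_1/x_3, x_2/x_3)$ the quotient of \<open>u\<close> is that of the radial harmonic oscillator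
  $\int t^2 (|f'|^2 + \lambda t^2 |f|^2)$ relative to $\int t^2 |f|^2$, where \<open>\<lambda>\<close> is the mean of $|a(y, 1)|^2$ over \<open>\<omega>\<close>, provided that
  $a_3(y, 1)$ has mean zero. The best such \<open>a\<close> has \<open>\<lambda>\<close> at most the square of $e(B, \omega)$, and the first \<open>n\<close> eigenvalues
  of the oscillator with $\lambda = c^2$ are $(4k-1) c$. Some nonzero \<open>u\<close> is orthogonal to any given \<open>n - 1\<close> functions.
\<close>

section \<open>Gaussian moments of polynomials\<close>

text \<open>The eigenfunctions of the oscillator are exp(-c t^2 / 2) times Laguerre polynomials of
  parameter 1/2 in c t^2, so the first n of them span exactly the polynomials in t^2 of degree below
  n times this Gaussian. The bound must hold on the whole span, because nothing is known about the
  trial function that is orthogonal to the given ones; hence an inequality for arbitrary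
  polynomials, obtained from ladder operators, takes the place of computations with single
  eigenfunctions. The orthogonality conditions are complex, so the coefficients are complex as well,
  and f then brings in a cross term 2 a_3 Im(conj f f'). Subtracting the mean d of a_3(y, 1) removes
  it and lowers the energy from e^2 to e^2 - d^2, so nothing is lost. A second obstacle is that
  \<open>magnetic_form\<close> evaluates a gradient chosen among all distributional ones. Computing
  it requires that two such gradients in L2 agree almost everywhere, hence smooth bump functions on
  boxes.\<close>

definition gauss_weight :: "real \<Rightarrow> real poly \<Rightarrow> real \<Rightarrow> real" where
  "gauss_weight c p t = indicator {0..} t * (poly p (t\<^sup>2) * exp (- c * t\<^sup>2))"

text \<open>With s = t^2 this is half the integral of p(s) s^(-1/2) exp(-c s) over s > 0, so a
  factor \<open>[:0,1:] ^ j\<close> in the argument produces the Laguerre weight of parameter j -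
  1/2. As a linear functional on polynomials it reduces the energy estimates to polynomial
  identities.\<close>

definition gauss_functional :: "real \<Rightarrow> real poly \<Rightarrow> real" where
  "gauss_functional c p = (LINT t|lborel. gauss_weight c p t)"

lemma gauss_weight_simps:
  "gauss_weight c (p + q) t = gauss_weight c p t + gauss_weight c q t"
  "gauss_weight c (p - q) t = gauss_weight c p t - gauss_weight c q t"
  "gauss_weight c (smult a p) t = a * gauss_weight c p t"
  "gauss_weight c 0 t = 0"
  by (auto simp: gauss_weight_def algebra_simps)

text \<open>The substitution sqrt c * t reduces this to the even Gaussian moments with c = 1; the
  power t^(2k) puts c^k and the differential puts sqrt c into the denominator.\<close>

lemma gauss_weight_monom:
  assumes "c > 0"
  shows "has_bochner_integral lborel (gauss_weight c (monom 1 k))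
    ((sqrt pi / 2) * (fact (2 * k) / (2 ^ (2 * k) * fact k)) / (sqrt c * c ^ k))"
proof -
  have r: "sqrt c > 0" "(sqrt c)\<^sup>2 = c" "sqrt c \<noteq> 0"
    using assms by auto
  define I where "I = (sqrt pi / 2) * (fact (2 * k) / (2 ^ (2 * k) * fact k) :: real)"
  have "has_bochner_integral lborel (\<lambda>x::real. indicator {0..} x *\<^sub>R (exp (-x\<^sup>2)*x^(2 * k))) I"
    unfolding I_def by (rule gaussian_moment_even_pos)
  then have "has_bochner_integral lborel (\<lambda>x::real. indicator {0..} (0 + sqrt c * x) *\<^sub>R
      (exp (-(0 + sqrt c * x)\<^sup>2)*(0 + sqrt c * x)^(2 * k))) (I /\<^sub>R \<bar>sqrt c\<bar>)"
    using lborel_has_bochner_integral_real_affine_iff[OF r(3), of _ I 0] by (simp only:)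
  then have "has_bochner_integral lborel (\<lambda>x::real. (1 / c ^ k) * (indicator {0..} (0 + sqrt c * x) *\<^sub>R
      (exp (-(0 + sqrt c * x)\<^sup>2)*(0 + sqrt c * x)^(2 * k)))) ((1 / c ^ k) * (I /\<^sub>R \<bar>sqrt c\<bar>))"
    by (rule has_bochner_integral_mult_right)
  moreover have "(1 / c ^ k) * (indicator {0..} (0 + sqrt c * x) *\<^sub>R
      (exp (-(0 + sqrt c * x)\<^sup>2)*(0 + sqrt c * x)^(2 * k))) = gauss_weight c (monom 1 k) x" for x
    using r assms by (auto simp: gauss_weight_def poly_monom power_mult_distrib power_mult
        zero_le_mult_iff split: split_indicator)
  moreover have "(1 / c ^ k) * (I /\<^sub>R \<bar>sqrt c\<bar>) = I / (sqrt c * c ^ k)"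
    using r by (simp add: field_simps)
  ultimately show ?thesis unfolding I_def by simp
qed

lemma gauss_weight_poly_expand:
  "gauss_weight c p t = (\<Sum>k\<le>degree p. coeff p k * gauss_weight c (monom 1 k) t)"
  unfolding gauss_weight_def poly_monom by (subst poly_altdef) (simp add: sum_distrib_left sum_distrib_right mult_ac)

lemma integrable_gauss_weight [simp]:
  assumes "c > 0" shows "integrable lborel (gauss_weight c p)"
  unfolding gauss_weight_poly_expand[of c p, abs_def]
  by (intro Bochner_Integration.integrable_sum integrable_mult_right)
    (use gauss_weight_monom[OF assms] in \<open>auto simp: has_bochner_integral_iff\<close>)

lemma gauss_functional_add:
  "c > 0 \<Longrightarrow> gauss_functional c (p + q) = gauss_functional c p + gauss_functional c q"
  by (simp add: gauss_functional_def gauss_weight_simps)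

lemma gauss_functional_diff:
  "c > 0 \<Longrightarrow> gauss_functional c (p - q) = gauss_functional c p - gauss_functional c q"
  by (simp add: gauss_functional_def gauss_weight_simps)

lemma gauss_functional_smult:
  "gauss_functional c (smult a p) = a * gauss_functional c p"
  by (simp add: gauss_functional_def gauss_weight_simps)

lemma gauss_functional_zero [simp]: "gauss_functional c 0 = 0"
  by (simp add: gauss_functional_def gauss_weight_simps)

lemma gauss_functional_nonneg:
  assumes "\<And>s. s \<ge> 0 \<Longrightarrow> poly p s \<ge> 0"
  shows "gauss_functional c p \<ge> 0"
  unfolding gauss_functional_def gauss_weight_def
  by (intro integral_nonneg_AE AE_I2) (use assms in auto)

lemma poly_induct_monom:
  fixes p :: "'a::comm_semiring_1 poly"
  assumes "P 0" "\<And>p q. P p \<Longrightarrow> P q \<Longrightarrow> P (p + q)" "\<And>a k. P (smult a (monom 1 k))"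
  shows "P p"
proof -
  have "P (\<Sum>i\<in>A. monom (coeff p i) i)" if "finite A" for A
    using that
  proof (induction A rule: finite_induct)
    case (insert i A)
    have "P (monom (coeff p i) i)"
      using assms(3)[of "coeff p i" i] by (simp add: smult_monom)
    then show ?case
      using insert assms(2) by simp
  qed (simp add: assms(1))
  then show ?thesis
    using poly_as_sum_of_monoms[of p] by (metis finite_atMost)
qed

text \<open>This is integration by parts: the derivative of $t q(t^2) e^{-ct^2}$ has integral zero.\<close>

lemma gauss_functional_recursion:
  assumes "c > 0"
  shows "c * gauss_functional c ([:0,1:] * q) =
    gauss_functional c (smult (1/2) q + [:0,1:] * pderiv q)"
proof (induction q rule: poly_induct_monom)
  case 1
  then show ?case by (simp del: mult_pCons_left)
next
  case (2 p q)
  then show ?case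
    using assms by (simp add: gauss_functional_add gauss_functional_smult smult_add_right
        ring_distribs pderiv_add del: mult_pCons_left)
next
  case (3 a k)
  \<comment> \<open>By linearity only monomials remain, and there the identity is the ratio (k +
    1/2) / c of consecutive explicit moments.\<close>
  have M: "gauss_functional c (monom 1 k) =
      (sqrt pi / 2) * (fact (2 * k) / (2 ^ (2 * k) * fact k)) / (sqrt c * c ^ k)" for k
    using gauss_weight_monom[OF assms, of k] unfolding gauss_functional_def
    by (rule has_bochner_integral_integral_eq)
  have X: "[:0,1:] * monom a k = monom a (Suc k)" for a :: real and k
    by (simp add: monom_Suc)
  have d: "smult (1/2) (monom 1 k) + [:0,1:] * pderiv (monom 1 k) = smult (k + 1/2) (monom 1 k :: real poly)"
  proof (cases k)
    case (Suc m)
    then show ?thesis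
      by (simp add: pderiv_monom X smult_monom add_monom del: mult_pCons_left)
  qed (simp add: pderiv_monom)
  have "c * gauss_functional c (monom 1 (Suc k)) = (k + 1/2) * gauss_functional c (monom 1 k)"
  proof -
    have "fact (2 * Suc k) = (2 * k + 2) * (2 * k + 1) * (fact (2 * k) :: real)"
      by (simp add: algebra_simps)
    then have "(fact (2 * Suc k) / (2 ^ (2 * Suc k) * fact (Suc k)) :: real) =
        (2 * (real k + 1) * (2 * real k + 1) * fact (2 * k)) / (4 * 2 ^ (2 * k) * ((real k + 1) * fact k))"
      by (simp add: algebra_simps)
    also have "\<dots> = (real k + 1/2) * (fact (2 * k) / (2 ^ (2 * k) * fact k))"
    proof -
      have "(2 * (r + 1) * (2 * r + 1) * F) / (4 * P * ((r + 1) * f)) = (r + 1/2) * (F / (P * f))"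
        if "r \<ge> 0" "f > 0" "P > 0" for r F f P :: real
      proof -
        have "(r + 1) * f \<noteq> 0" "4 * P \<noteq> 0" using that by auto
        then show ?thesis using that by (simp add: divide_simps) (simp add: algebra_simps)
      qed
      from this[of "real k" "fact k" "2 ^ (2 * k)" "fact (2 * k)"] show ?thesis
        by (simp only: of_nat_0_le_iff fact_gt_zero zero_less_power zero_less_numeral)
    qed
    finally show ?thesis
      using assms unfolding M by (simp only: power_Suc) (simp add: divide_simps)
  qed
  then show ?case
    using d by (metis (no_types, lifting) X mult_smult_right pderiv_smult smult_add_right
        gauss_functional_smult mult.left_commute smult_smult mult.commute)
qed

text \<open>In the recursion for X^j q the Euler operator X d/dX produces an additional j X^j q,
  which turns 1/2 into j + 1/2.\<close>

lemma gauss_functional_recursion_power: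
  assumes "c > 0"
  shows "c * gauss_functional c ([:0,1:] ^ Suc j * q) =
    gauss_functional c ([:0,1:] ^ j * (smult (j + 1/2) q + [:0,1:] * pderiv q))"
proof -
  define X :: "real poly" where "X = [:0,1:]"
  have dX: "pderiv X = 1"
    by (simp add: X_def pderiv_pCons)
  have "X * pderiv (X ^ j) = of_nat j * X ^ j"
    by (induction j) (simp_all add: pderiv_mult dX algebra_simps)
  then have "smult (1/2) (X ^ j * q) + X * pderiv (X ^ j * q)
      = smult (1/2) (X ^ j * q) + (of_nat j * X ^ j * q + X ^ j * (X * pderiv q))"
    by (simp add: pderiv_mult algebra_simps)
  also have "\<dots> = X ^ j * (smult (j + 1/2) q + X * pderiv q)"
    by (intro iffD1[OF poly_eq_poly_eq_iff] ext) (simp add: power2_eq_square algebra_simps)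
  finally show ?thesis
    using gauss_functional_recursion[OF assms, of "X ^ j * q"]
    by (simp add: mult.assoc X_def[symmetric])
qed

text \<open>The polynomials of degree at most \<open>m\<close> are invariant under the number operator \<open>D' D\<close>, where \<open>D\<close> is the
  derivative and \<open>D'\<close> its adjoint from the weight \<open>j + 1\<close> to the weight \<open>j\<close>. The commutation rule
  \<open>D D' = c + D' D\<close> (with all weights shifted by one on the right) drives the induction.\<close>

lemma gauss_functional_pderiv_bound:
  assumes c: "c > 0" and "degree p \<le> m"
  shows "gauss_functional c ([:0,1:] ^ Suc j * (pderiv p)\<^sup>2) \<le> m * c * gauss_functional c ([:0,1:] ^ j * p\<^sup>2)"
  using assms(2)
proof (induction m arbitrary: p j)
  case 0
  then have "pderiv p = 0"
    by (simp add: pderiv_eq_0_iff)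
  then show ?case by simp
next
  case (Suc m)
  define X :: "real poly" where "X = [:0,1:]"
  define G where "G = gauss_functional c"
  have dX: "pderiv X = 1"
    by (simp add: X_def pderiv_pCons)
  note lin = gauss_functional_add[OF c, folded G_def] gauss_functional_diff[OF c, folded G_def]
    gauss_functional_smult[of c, folded G_def]
  have rec: "c * G (X ^ Suc j * q) = G (X ^ j * (smult (j + 1/2) q + X * pderiv q))" for j q
    unfolding G_def X_def by (rule gauss_functional_recursion_power[OF c])
  \<comment> \<open>This is the adjoint D' of the preceding text, not the derivative. Its form is
    read off from the recursion for the product of p and q, solved for the term that contains
    p'.\<close>
  define D where "D = (\<lambda>j q. smult c (X * q) - smult (j + 1/2) q - X * pderiv q)"
  have adj: "G (X ^ Suc j * (pderiv p * q)) = G (X ^ j * (p * D j q))" for j p q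
  proof -
    have "X ^ j * (p * D j q) = smult c (X ^ Suc j * (p * q)) - X ^ j * (smult (j + 1/2) (p * q) + X * pderiv (p * q))
        + X ^ Suc j * (pderiv p * q)"
      unfolding D_def pderiv_mult
      by (intro iffD1[OF poly_eq_poly_eq_iff] ext) (simp add: algebra_simps)
    then have "G (X ^ j * (p * D j q)) = c * G (X ^ Suc j * (p * q)) - G (X ^ j * (smult (j + 1/2) (p * q) + X * pderiv (p * q)))
        + G (X ^ Suc j * (pderiv p * q))"
      by (simp only: lin)
    then show ?thesis using rec[of j "p * q"] by simp
  qed
  define q where "q = pderiv p"
  have dq: "degree q \<le> m"
    using Suc.prems by (simp add: q_def degree_pderiv)
  \<comment> \<open>The product rule on X q' yields an additional q', which raises j + 1/2 to j +
    3/2: this is the shift of the weight in the commutation rule.\<close>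
  have dD: "pderiv (D j q) = smult c q + D (Suc j) (pderiv q)"
    unfolding D_def pderiv_diff pderiv_smult pderiv_mult dX
    by (intro iffD1[OF poly_eq_poly_eq_iff] ext) (simp add: algebra_simps)
  have "G (X ^ j * (D j q * D j q)) = G (X ^ Suc j * (q * pderiv (D j q)))"
    using adj[of j "D j q" q] by (simp add: mult_ac)
  also have "X ^ Suc j * (q * pderiv (D j q)) = smult c (X ^ Suc j * q\<^sup>2) + X ^ Suc j * (q * D (Suc j) (pderiv q))"
    unfolding dD by (simp add: algebra_simps power2_eq_square)
  also have "G \<dots> = c * G (X ^ Suc j * q\<^sup>2) + G (X ^ Suc (Suc j) * (pderiv q * pderiv q))"
    by (simp only: lin adj)
  \<comment> \<open>The induction hypothesis is applied to q = p', of degree at most m, one weight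
    higher; the commutator supplies the remaining c.\<close>
  also have "\<dots> \<le> c * G (X ^ Suc j * q\<^sup>2) + m * c * G (X ^ Suc j * q\<^sup>2)"
    using Suc.IH[OF dq, of "Suc j"] by (simp add: G_def X_def power2_eq_square)
  finally have *: "G (X ^ j * (D j q * D j q)) \<le> Suc m * c * G (X ^ Suc j * q\<^sup>2)"
    by (simp add: algebra_simps)
  define a where "a = Suc m * c"
  have a: "a > 0" using c by (simp add: a_def)
  \<comment> \<open>Adjointness gives |q|^2 = (p, D' q). The square then converts the bound |D' q|^2
    <= a |q|^2 into |q|^2 <= a |p|^2, as Cauchy-Schwarz would, but without a division.\<close>
  have "0 \<le> G (X ^ j * (smult a p - D j q)\<^sup>2)"
    unfolding G_def by (rule gauss_functional_nonneg) (simp add: X_def)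
  also have "X ^ j * (smult a p - D j q)\<^sup>2 = smult (a\<^sup>2) (X ^ j * p\<^sup>2) - smult (2 * a) (X ^ j * (p * D j q))
      + X ^ j * (D j q * D j q)"
    by (intro iffD1[OF poly_eq_poly_eq_iff] ext) (simp add: power2_eq_square algebra_simps)
  also have "G \<dots> = a\<^sup>2 * G (X ^ j * p\<^sup>2) - 2 * a * G (X ^ Suc j * q\<^sup>2) + G (X ^ j * (D j q * D j q))"
    by (simp only: lin adj[symmetric] q_def power2_eq_square)
  also have "\<dots> \<le> a\<^sup>2 * G (X ^ j * p\<^sup>2) - a * G (X ^ Suc j * q\<^sup>2)"
    using * unfolding a_def by (simp add: algebra_simps)
  also have "\<dots> = a * (a * G (X ^ j * p\<^sup>2) - G (X ^ Suc j * q\<^sup>2))"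
    by (simp add: power2_eq_square algebra_simps)
  finally have "a * G (X ^ j * p\<^sup>2) - G (X ^ Suc j * q\<^sup>2) \<ge> 0"
    using a by (simp add: zero_le_mult_iff)
  then show ?case by (simp add: a_def G_def X_def q_def)
qed

text \<open>On the left is the energy $\int t^2 (|f'|^2 + c^2 t^2 |f|^2)$ of $f(t) = p(t^2) e^{-ct^2/2}$.\<close>

lemma gauss_functional_oscillator_bound:
  assumes c: "c > 0" and "degree p \<le> m"
  shows "gauss_functional c ([:0,1:] ^ 2 * ((smult 2 (pderiv p) - smult c p)\<^sup>2 + smult (c\<^sup>2) (p\<^sup>2)))
    \<le> (4 * m + 3) * c * gauss_functional c ([:0,1:] * p\<^sup>2)"
proof -
  define X :: "real poly" where "X = [:0,1:]"
  define G where "G = gauss_functional c"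
  note lin = gauss_functional_add[OF c, folded G_def] gauss_functional_diff[OF c, folded G_def]
    gauss_functional_smult[of c, folded G_def]
  have rec: "c * G (X ^ Suc j * q) = G (X ^ j * (smult (j + 1/2) q + X * pderiv q))" for j q
    unfolding G_def X_def by (rule gauss_functional_recursion_power[OF c])
  have "X ^ 2 * ((smult 2 (pderiv p) - smult c p)\<^sup>2 + smult (c\<^sup>2) (p\<^sup>2)) =
     smult 4 (X ^ 2 * (pderiv p)\<^sup>2) - smult (4 * c) (X ^ 2 * (p * pderiv p)) + smult (2 * c\<^sup>2) (X ^ 2 * p\<^sup>2)"
    by (intro iffD1[OF poly_eq_poly_eq_iff] ext) (simp add: power2_eq_square algebra_simps)
  then have 1: "G (X ^ 2 * ((smult 2 (pderiv p) - smult c p)\<^sup>2 + smult (c\<^sup>2) (p\<^sup>2))) =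
      4 * G (X ^ 2 * (pderiv p)\<^sup>2) - 4 * c * G (X ^ 2 * (p * pderiv p)) + 2 * c * (c * G (X ^ 2 * p\<^sup>2))"
    by (simp only: lin) (simp add: power2_eq_square)
  have "c * G (X ^ 2 * p\<^sup>2) = G (X * (smult (3/2) (p\<^sup>2) + X * pderiv (p\<^sup>2)))"
    using rec[of 1 "p\<^sup>2"] by (simp add: numeral_2_eq_2)
  also have "X * (smult (3/2) (p\<^sup>2) + X * pderiv (p\<^sup>2)) = smult (3/2) (X * p\<^sup>2) + smult 2 (X ^ 2 * (p * pderiv p))"
    unfolding power2_eq_square pderiv_mult
    by (intro iffD1[OF poly_eq_poly_eq_iff] ext) (simp add: power2_eq_square algebra_simps)
  \<comment> \<open>Inserted into the expansion above, this cancels the mixed terms in p p' and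
    leaves 4 G(X^2 p'^2) + 3 c G(X p^2). The 3 c is the ground state energy; the ladder bound
    contributes the 4 m c.\<close>
  finally have 2: "c * G (X ^ 2 * p\<^sup>2) = 3/2 * G (X * p\<^sup>2) + 2 * G (X ^ 2 * (p * pderiv p))"
    by (simp only: lin)
  have 3: "G (X ^ 2 * (pderiv p)\<^sup>2) \<le> m * c * G (X * p\<^sup>2)"
    using gauss_functional_pderiv_bound[OF assms, of 1] by (simp add: numeral_2_eq_2 G_def X_def)
  show ?thesis
    using 3 unfolding 1[unfolded G_def X_def] G_def X_def 2[unfolded G_def X_def] by (simp add: algebra_simps)
qed

section \<open>Test functions\<close>

lemma sigma_finite_lebesgue: "sigma_finite_measure (lebesgue :: 'a::euclidean_space measure)"
proof
  let ?B = "\<lambda>n::nat. box (- (real n *\<^sub>R One)) (real n *\<^sub>R One) :: 'a set"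
  show "\<exists>A::'a set set. countable A \<and> A \<subseteq> sets lebesgue \<and> \<Union>A = space lebesgue \<and> (\<forall>a\<in>A. emeasure lebesgue a \<noteq> \<infinity>)"
    by (rule exI[of _ "range ?B"]) (auto simp: UN_box_eq_UNIV emeasure_lborel_box_eq)
qed

text \<open>Boxes form an intersection-stable generator of the Borel sets, so the integrals vanish
  on all Borel sets by a Dynkin argument, and then on all Lebesgue sets, which are Borel up to null
  sets.\<close>

lemma AE_zero_if_box_integrals_zero:
  fixes F :: "'a::euclidean_space \<Rightarrow> 'b::{banach, second_countable_topology}"
  assumes F: "integrable lebesgue F"
    and box: "\<And>a b. set_lebesgue_integral lebesgue (box a b) F = 0"
  shows "AE x in lebesgue. F x = 0"
proof (rule sigma_finite_measure.density_zero[OF sigma_finite_lebesgue F])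
  have si: "set_integrable lebesgue S F" if "S \<in> sets lebesgue" for S
    unfolding set_integrable_def using that F by (rule integrable_mult_indicator)
  \<comment> \<open>Complements in the Dynkin system require the integral over the whole space to
    vanish; it is reached by exhausting the space with boxes.\<close>
  let ?B = "\<lambda>n::nat. box (- (real n *\<^sub>R One)) (real n *\<^sub>R One) :: 'a set"
  have "(\<lambda>n. set_lebesgue_integral lebesgue (?B n) F) \<longlonglongrightarrow> set_lebesgue_integral lebesgue (\<Union>n. ?B n) F"
  proof (rule set_integral_cont_up)
    show "incseq ?B"
      by (auto simp: incseq_def mem_box intro: less_le_trans le_less_trans) 
        (smt (verit, best) inner_Basis inner_sum_left of_nat_mono)+
  qed (auto intro!: si)
  then have tot: "set_lebesgue_integral lebesgue UNIV F = 0"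
    using box by (simp add: UN_box_eq_UNIV LIMSEQ_const_iff)
  have borel: "set_lebesgue_integral lebesgue S F = 0" if "S \<in> sets borel" for S
  proof -
    have leb: "A \<in> sets lebesgue" if "A \<in> sigma_sets UNIV (range (\<lambda>(a, b). box a b :: 'a set))" for A
    proof -
      have "A \<in> sets borel"
        using that by (simp add: borel_eq_box)
      then show ?thesis by auto
    qed
    have "Int_stable (range (\<lambda>(a, b). box a b :: 'a set))"
      by (auto simp: Int_stable_def box_Int_box)
    moreover have "range (\<lambda>(a, b). box a b :: 'a set) \<subseteq> Pow UNIV" by simp
    moreover have "S \<in> sigma_sets UNIV (range (\<lambda>(a, b). box a b :: 'a set))"
      using that by (simp add: borel_eq_box)
    ultimately show ?thesis
    proof (induction rule: sigma_sets_induct_disjoint)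
      case (compl A)
      have "set_lebesgue_integral lebesgue (UNIV - A \<union> A) F =
          set_lebesgue_integral lebesgue (UNIV - A) F + set_lebesgue_integral lebesgue A F"
        by (rule set_integral_Un) (use compl leb in \<open>auto intro!: si\<close>)
      then show ?case
        using compl tot by simp
    next
      case (union A)
      have A: "A i \<in> sets lebesgue" for i
        using union(2) leb by blast
      have "set_lebesgue_integral lebesgue (\<Union>i. A i) F = (\<Sum>i. set_lebesgue_integral lebesgue (A i) F)"
        by (rule lebesgue_integral_countable_add)
          (use union(1) A in \<open>auto intro!: si simp: disjoint_family_on_def\<close>)
      then show ?case
        using union by simp
    qed (use box in \<open>auto simp: set_lebesgue_integral_def\<close>)
  qed
  fix A :: "'a set"
  assume A: "A \<in> sets lebesgue"
  then obtain S N N' where S: "A = S \<union> N" "N \<subseteq> N'" "N' \<in> null_sets lborel" "S \<in> sets lborel"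
    by (rule sets_completionE)
  have "set_lebesgue_integral lebesgue A F = set_lebesgue_integral lebesgue S F"
  proof (rule set_integral_cong_set)
    have "N' \<in> null_sets lebesgue"
      using S(3) by (rule null_sets_completionI)
    then show "AE x in lebesgue. (x \<in> S) = (x \<in> A)"
      by (rule AE_I') (use S in auto)
  qed (use S A si in \<open>auto simp: set_integrable_def set_borel_measurable_def sets_completionI_sets intro!: borel_measurable_integrable\<close>)
  then show "set_lebesgue_integral lebesgue A F = 0"
    using borel S by simp
qed

section \<open>Partial derivatives and closure properties of \<open>Ck\<close>\<close>

lemma partial_eq:
  assumes "(f has_derivative D) (at x)"
  shows "partial i f x = D (axis i 1)"
  unfolding partial_def using frechet_derivative_at[OF assms] by simp

lemma partial_const [simp]: "partial i (\<lambda>x. c) = (\<lambda>x. 0)"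
  by (rule ext, subst partial_eq) (auto intro: derivative_eq_intros)

lemma Ck_const [simp]: "Ck k (\<lambda>x. c)"
  by (induction k arbitrary: c) auto

lemma Ck_SucD: "Ck (Suc k) f \<Longrightarrow> Ck k f"
proof (induction k arbitrary: f)
  case 0
  then show ?case
    by (auto intro!: continuous_at_imp_continuous_on differentiable_imp_continuous_within)
next
  case (Suc k)
  from Suc.prems have "\<And>x. f differentiable at x" "\<And>i. Ck (Suc k) (partial i f)"
    by auto
  then show ?case using Suc.IH by (auto simp only: Ck.simps(2)[of k f])
qed

lemma Ck_add:
  "Ck k f \<Longrightarrow> Ck k g \<Longrightarrow> Ck k (\<lambda>x. f x + g x)"
proof (induction k arbitrary: f g)
  case (Suc k)
  have "partial i (\<lambda>x. f x + g x) = (\<lambda>x. partial i f x + partial i g x)" for i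
  proof
    fix x
    show "partial i (\<lambda>x. f x + g x) x = partial i f x + partial i g x"
      using Suc.prems has_derivative_add[of f "frechet_derivative f (at x)" "at x" g "frechet_derivative g (at x)"]
      by (subst partial_eq) (auto simp: frechet_derivative_works partial_def)
  qed
  then show ?case using Suc by (auto intro!: differentiable_add)
qed (auto intro: continuous_intros)

lemma partial_mult:
  fixes f g :: "real^'n \<Rightarrow> 'a::real_normed_algebra"
  assumes "f differentiable at x" "g differentiable at x"
  shows "partial i (\<lambda>x. f x * g x) x = f x * partial i g x + partial i f x * g x"
  using assms has_derivative_mult[of f "frechet_derivative f (at x)" x UNIV g "frechet_derivative g (at x)"]
  by (subst partial_eq) (auto simp: frechet_derivative_works partial_def)

lemma Ck_mult:
  fixes f g :: "real^'n \<Rightarrow> 'a::real_normed_algebra"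
  shows "Ck k f \<Longrightarrow> Ck k g \<Longrightarrow> Ck k (\<lambda>x. f x * g x)"
proof (induction k arbitrary: f g)
  case (Suc k)
  have "partial i (\<lambda>x. f x * g x) = (\<lambda>x. f x * partial i g x + partial i f x * g x)" for i
    using Suc.prems by (auto intro!: partial_mult)
  moreover have "Ck k f" "Ck k g"
    using Suc.prems by (auto intro: Ck_SucD)
  ultimately show ?case using Suc by (auto intro!: Ck_add differentiable_mult)
qed (auto intro: continuous_intros)

lemma Ck_prod:
  fixes f :: "'i \<Rightarrow> real^'n \<Rightarrow> 'a::{real_normed_algebra,comm_ring_1}"
  assumes "\<And>i. i \<in> I \<Longrightarrow> Ck k (f i)"
  shows "Ck k (\<lambda>x. \<Prod>i\<in>I. f i x)"
  using assms by (induction I rule: infinite_finite_induct) (auto intro: Ck_mult)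

text \<open>The induction needs a whole family closed under differentiation and an arbitrary factor
  \<open>a\<close>: the partial derivative along \<open>i\<close> raises \<open>m\<close> and
  multiplies \<open>a\<close> by \<alpha>, and every other one is the same expression with factor
  0.\<close>

lemma Ck_affine_coordinate:
  fixes G :: "nat \<Rightarrow> real \<Rightarrow> real"
  assumes G: "\<And>m t. (G m has_real_derivative G (Suc m) t) (at t)"
  shows "Ck k (\<lambda>x::real^'n. complex_of_real (a * G m (\<alpha> * x $ i + \<beta>)))"
proof (induction k arbitrary: a m)
  case 0
  have "continuous_on UNIV (G m)"
    using G DERIV_continuous_on by blast
  then show ?case
    by (auto intro!: continuous_intros continuous_on_compose2[of UNIV "G m"])
next
  case (Suc k)
  have D: "((\<lambda>x::real^'n. complex_of_real (a * G m (\<alpha> * x $ i + \<beta>))) has_derivative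
      (\<lambda>h. complex_of_real (a * (\<alpha> * h $ i * G (Suc m) (\<alpha> * x $ i + \<beta>))))) (at x)" for x
  proof -
    have "((\<lambda>x::real^'n. G m (\<alpha> * x $ i + \<beta>)) has_derivative
      (\<lambda>h. \<alpha> * h $ i * G (Suc m) (\<alpha> * x $ i + \<beta>))) (at x)"
      by (rule DERIV_compose_FDERIV[OF G]) (auto intro!: derivative_eq_intros bounded_linear_imp_has_derivative)
    then show ?thesis
      by (intro has_derivative_of_real has_derivative_mult_right)
  qed
  have "partial j (\<lambda>x::real^'n. complex_of_real (a * G m (\<alpha> * x $ i + \<beta>))) =
      (\<lambda>x. complex_of_real ((if j = i then a * \<alpha> else 0) * G (Suc m) (\<alpha> * x $ i + \<beta>)))" for j
    by (rule ext, subst partial_eq[OF D]) (auto simp: axis_def)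
  then show ?case
    using D Suc.IH by (auto simp: differentiable_def)
qed

section \<open>Smooth bump functions supported in boxes\<close>

definition flat_exp :: "real poly \<Rightarrow> real \<Rightarrow> real" where
  "flat_exp p t = (if t > 0 then poly p (1 / t) * exp (- (1 / t)) else 0)"

lemma tendsto_poly_times_exp_minus: "((\<lambda>s::real. poly p s * exp (- s)) \<longlongrightarrow> 0) at_top"
proof -
  have "((\<lambda>s. \<Sum>i\<le>degree p. coeff p i * (s ^ i / exp s)) \<longlongrightarrow> (\<Sum>i\<le>degree p. coeff p i * 0)) at_top"
    by (intro tendsto_sum tendsto_mult_left tendsto_power_div_exp_0)
  then show ?thesis
    by (simp add: poly_altdef exp_minus divide_inverse sum_distrib_right mult.assoc)
qed

text \<open>For s = 1/t one has d/dt = - s^2 d/ds, which sends p(s) exp(-s) to s^2 (p - p')(s)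
  exp(-s). Carrying a polynomial factor in 1/t closes the family under differentiation; smoothness
  of exp(-1/t) is the case p = 1. At 0 the difference quotient from the right is s p(s) exp(-s) with
  s tending to infinity.\<close>

lemma flat_exp_has_derivative:
  "(flat_exp p has_real_derivative flat_exp ([:0,0,1:] * (p - pderiv p)) t) (at t)"
proof -
  consider "t < 0" | "t = 0" | "t > 0" by linarith
  then show ?thesis
  proof cases
    case 1
    have "((\<lambda>t. 0) has_real_derivative 0) (at t)" by simp
    then have "(flat_exp p has_real_derivative 0) (at t)"
      by (rule DERIV_cong_ev[THEN iffD1, rotated 3, OF _ refl _ refl])
        (use 1 eventually_nhds_in_open[of "{..<0}" t] in \<open>auto simp: flat_exp_def elim!: eventually_mono\<close>)
    then show ?thesis using 1 by (simp add: flat_exp_def)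
  next
    case 3
    have "((\<lambda>t. poly p (1 / t) * exp (- (1 / t))) has_real_derivative
        poly ([:0,0,1:] * (p - pderiv p)) (1 / t) * exp (- (1 / t))) (at t)"
      using 3 by (auto intro!: derivative_eq_intros DERIV_chain'[OF _ poly_DERIV] simp: field_simps power2_eq_square)
    then have "(flat_exp p has_real_derivative poly ([:0,0,1:] * (p - pderiv p)) (1 / t) * exp (- (1 / t))) (at t)"
      by (rule DERIV_cong_ev[THEN iffD1, rotated 3, OF _ refl _ refl])
        (use 3 eventually_nhds_in_open[of "{0<..}" t] in \<open>auto simp: flat_exp_def elim!: eventually_mono\<close>)
    then show ?thesis using 3 by (simp add: flat_exp_def)
  next
    case 2
    have "((\<lambda>h. flat_exp p h / h) \<longlongrightarrow> 0) (at 0)"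
    proof (rule filterlim_split_at)
      have "eventually (\<lambda>h::real. 0 = flat_exp p h / h) (at_left 0)"
        using eventually_at_left_real[of "-1" 0] by (auto simp: flat_exp_def elim!: eventually_mono)
      then show "((\<lambda>h. flat_exp p h / h) \<longlongrightarrow> 0) (at_left 0)"
        by (rule Lim_transform_eventually[rotated]) simp
      have "((\<lambda>h. poly ([:0,1:] * p) (inverse h) * exp (- inverse h)) \<longlongrightarrow> 0) (at_right (0::real))"
        by (rule filterlim_compose[OF tendsto_poly_times_exp_minus filterlim_inverse_at_top_right])
      moreover have "eventually (\<lambda>h::real. poly ([:0,1:] * p) (inverse h) * exp (- inverse h) = flat_exp p h / h) (at_right 0)"
        using eventually_at_right_less[of 0]
        by (auto simp: flat_exp_def field_simps elim!: eventually_mono)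
      ultimately show "((\<lambda>h. flat_exp p h / h) \<longlongrightarrow> 0) (at_right 0)"
        by (rule Lim_transform_eventually)
    qed
    then show ?thesis
      using 2 by (simp add: DERIV_def flat_exp_def)
  qed
qed

text \<open>For every k the bump is positive exactly on the open box, and as k grows it tends to the
  indicator, since exp(-1 / ((k+1) s)) tends to 1. The factor \<open>Suc k\<close> rather than
  \<open>k\<close> keeps the bump nonzero at k = 0.\<close>

definition box_bump :: "real^'n \<Rightarrow> real^'n \<Rightarrow> nat \<Rightarrow> real^'n \<Rightarrow> real" where
  "box_bump a b k x =
     (\<Prod>i\<in>UNIV. flat_exp 1 (Suc k * (x $ i - a $ i)) * flat_exp 1 (Suc k * (b $ i - x $ i)))"

lemma Ck_flat_exp_affine:
  "Ck k (\<lambda>x::real^'n. complex_of_real (flat_exp p (\<alpha> * x $ i + \<beta>)))"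
  using Ck_affine_coordinate[of "\<lambda>m. flat_exp (((\<lambda>q. [:0,0,1:] * (q - pderiv q)) ^^ m) p)" k 1 0 \<alpha> i \<beta>]
    flat_exp_has_derivative by simp

lemma Ck_box_bump: "Ck m (\<lambda>x. complex_of_real (box_bump a b k x))"
proof -
  have eq: "(\<lambda>x. complex_of_real (box_bump a b k x)) = (\<lambda>x. \<Prod>i\<in>UNIV.
      complex_of_real (flat_exp 1 (Suc k * x $ i + (- (Suc k * a $ i)))) *
      complex_of_real (flat_exp 1 ((- Suc k) * x $ i + Suc k * b $ i)))"
    by (simp add: box_bump_def algebra_simps)
  show ?thesis unfolding eq by (intro Ck_prod Ck_mult Ck_flat_exp_affine)
qed

lemma flat_exp_one_bounds: "0 \<le> flat_exp 1 t" "flat_exp 1 t \<le> 1"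
  by (auto simp: flat_exp_def)

lemma box_bump_nonneg: "0 \<le> box_bump a b k x"
  unfolding box_bump_def by (intro prod_nonneg mult_nonneg_nonneg flat_exp_one_bounds ballI)

lemma box_bump_le_1: "box_bump a b k x \<le> 1"
  unfolding box_bump_def
  by (intro prod_le_1) (auto intro!: mult_le_one simp: flat_exp_one_bounds)

lemma box_bump_nonzero_iff: "box_bump a b k x \<noteq> 0 \<longleftrightarrow> x \<in> box a b"
  by (auto simp: box_bump_def mem_box_cart flat_exp_def zero_less_mult_iff)

lemma box_bump_tendsto:
  assumes "x \<in> box a b"
  shows "(\<lambda>k. box_bump a b k x) \<longlonglongrightarrow> 1"
proof -
  have *: "(\<lambda>k. flat_exp 1 (Suc k * t)) \<longlonglongrightarrow> 1" if "t > 0" for t :: real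
  proof -
    have "(\<lambda>k. exp (- ((1 / t) * inverse (real (Suc k))))) \<longlonglongrightarrow> exp (- ((1 / t) * 0))"
      by (intro tendsto_intros LIMSEQ_inverse_real_of_nat)
    moreover have "flat_exp 1 (Suc k * t) = exp (- ((1 / t) * inverse (real (Suc k))))" for k
      using that by (simp add: flat_exp_def field_simps add_pos_nonneg)
    ultimately show ?thesis
      by simp
  qed
  have "(\<lambda>k. box_bump a b k x) \<longlonglongrightarrow> (\<Prod>i\<in>(UNIV::'a set). 1 * 1)"
    unfolding box_bump_def
    by (intro tendsto_prod tendsto_mult *) (use assms in \<open>auto simp: mem_box_cart\<close>)
  then show ?thesis by simp
qed

lemma box_bump_test_function:
  assumes "cbox a b \<subseteq> \<Omega>"
  shows "(\<lambda>x. complex_of_real (box_bump a b k x)) \<in> test_functions \<Omega>"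
proof -
  have "closure {x. complex_of_real (box_bump a b k x) \<noteq> 0} \<subseteq> cbox a b"
    by (rule closure_minimal) (auto simp: box_bump_nonzero_iff intro: box_subset_cbox[THEN subsetD])
  moreover have "compact (closure {x. complex_of_real (box_bump a b k x) \<noteq> 0})"
    using calculation by (metis bounded_cbox bounded_subset closed_closure compact_eq_bounded_closed)
  ultimately show ?thesis
    using assms Ck_box_bump by (auto simp: test_functions_def)
qed

lemma box_bump_measurable [measurable]: "box_bump a b k \<in> borel_measurable borel"
proof -
  have "continuous_on UNIV (\<lambda>x. complex_of_real (box_bump a b k x))"
    using Ck_box_bump[of 0] by simp
  then have "continuous_on UNIV (\<lambda>x. Re (complex_of_real (box_bump a b k x)))"
    by (rule continuous_on_Re)
  then show ?thesis
    unfolding Re_complex_of_real by (rule borel_measurable_continuous_onI)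
qed

text \<open>Bumps increase to the indicator of an open box and are bounded by 1, so dominated
  convergence makes the integral of w vanish over each box whose closed version lies in \<Omega>.
  The criterion for box integrals then applies to w cut off to one box at a time.\<close>

lemma fundamental_lemma:
  fixes w :: "real^'n \<Rightarrow> complex"
  assumes "open \<Omega>"
    and int: "\<And>a b. cbox a b \<subseteq> \<Omega> \<Longrightarrow> integrable lebesgue (\<lambda>x. indicator (cbox a b) x *\<^sub>R w x)"
    and zero: "\<And>\<phi>. \<phi> \<in> test_functions \<Omega> \<Longrightarrow> (LINT x|lebesgue_on \<Omega>. w x * \<phi> x) = 0"
  shows "AE x in lebesgue_on \<Omega>. w x = 0"
proof -
  have \<Omega>: "\<Omega> \<in> sets lebesgue"
    using \<open>open \<Omega>\<close> by (intro sets_completionI_sets) auto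
  have box: "set_lebesgue_integral lebesgue (box a b) w = 0" if ab: "cbox a b \<subseteq> \<Omega>" for a b
  proof -
    let ?s = "\<lambda>k x. indicator \<Omega> x *\<^sub>R (w x * complex_of_real (box_bump a b k x))"
    have s_eq: "?s k x = complex_of_real (box_bump a b k x) * (indicator (cbox a b) x *\<^sub>R w x)" for k x
      using ab box_bump_nonzero_iff[of a b k x] box_subset_cbox[of a b]
      by (auto split: split_indicator)
    have "(\<lambda>k. LINT x|lebesgue. ?s k x) \<longlonglongrightarrow> (LINT x|lebesgue. indicator (box a b) x *\<^sub>R w x)"
    proof (rule integral_dominated_convergence)
      show "integrable lebesgue (\<lambda>x. norm (indicator (cbox a b) x *\<^sub>R w x))"
        using int[OF ab] by (rule integrable_norm)
      show "AE x in lebesgue. (\<lambda>k. ?s k x) \<longlonglongrightarrow> indicator (box a b) x *\<^sub>R w x"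
      proof (rule AE_I2)
        fix x :: "real^'n"
        show "(\<lambda>k. ?s k x) \<longlonglongrightarrow> indicator (box a b) x *\<^sub>R w x"
        proof (cases "x \<in> box a b")
          case True
          have "(\<lambda>k. complex_of_real (box_bump a b k x) * (indicator (cbox a b) x *\<^sub>R w x)) \<longlonglongrightarrow>
             complex_of_real 1 * (indicator (cbox a b) x *\<^sub>R w x)"
            by (intro tendsto_intros box_bump_tendsto True)
          then show ?thesis
            unfolding s_eq using True box_subset_cbox[of a b] by (auto split: split_indicator)
        next
          case False
          then show ?thesis
            using box_bump_nonzero_iff[of a b _ x] by simp
        qed
      qed
      show "AE x in lebesgue. norm (?s k x) \<le> norm (indicator (cbox a b) x *\<^sub>R w x)" for k
        unfolding s_eq norm_mult using box_bump_nonneg[of a b k] box_bump_le_1[of a b k]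
        by (intro AE_I2 mult_left_le_one_le) (auto simp: abs_of_nonneg)
      have m: "(\<lambda>x. indicator (cbox a b) x *\<^sub>R w x) \<in> borel_measurable lebesgue"
        using int[OF ab] by (rule borel_measurable_integrable)
      have bm: "(\<lambda>x. complex_of_real (box_bump a b k x)) \<in> borel_measurable lebesgue" for k
        by (rule measurable_completion) simp
      show "?s k \<in> borel_measurable lebesgue" for k
        unfolding s_eq using m bm by (rule borel_measurable_times[rotated])
      have "(\<lambda>x. indicator (box a b) x *\<^sub>R (indicator (cbox a b) x *\<^sub>R w x)) \<in> borel_measurable lebesgue"
        by (rule borel_measurable_scaleR[OF borel_measurable_indicator m]) auto
      also have "(\<lambda>x. indicator (box a b) x *\<^sub>R (indicator (cbox a b) x *\<^sub>R w x)) = (\<lambda>x. indicator (box a b) x *\<^sub>R w x)"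
        using box_subset_cbox[of a b] by (auto simp: fun_eq_iff indicator_def)
      finally show "(\<lambda>x. indicator (box a b) x *\<^sub>R w x) \<in> borel_measurable lebesgue" .
    qed
    moreover have "(LINT x|lebesgue. ?s k x) = 0" for k
      using zero[OF box_bump_test_function[OF ab, of k]] \<Omega> by (simp add: integral_restrict_space)
    ultimately show ?thesis
      unfolding set_lebesgue_integral_def by (simp add: LIMSEQ_const_iff)
  qed
  \<comment> \<open>An open set is a countable union of closed boxes, so it suffices to treat one
    box and collect countably many null sets.\<close>
  obtain D where D: "countable D" "D \<subseteq> Pow \<Omega>" "\<And>X. X \<in> D \<Longrightarrow> \<exists>a b. X = cbox a b" "\<Union>D = \<Omega>"
    using open_countable_Union_open_cbox[OF \<open>open \<Omega>\<close>] by metis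
  have "AE x in lebesgue. x \<in> X \<longrightarrow> w x = 0" if XD: "X \<in> D" for X
  proof -
    obtain a b where X: "X = cbox a b"
      using D(3)[OF XD] by blast
    moreover have "X \<subseteq> \<Omega>"
      using D(2) XD by blast
    ultimately have X: "X = cbox a b" "cbox a b \<subseteq> \<Omega>"
      by simp_all
    define F where "F = (\<lambda>x. indicator (box a b) x *\<^sub>R w x)"
    have F: "integrable lebesgue F"
    proof -
      have "integrable lebesgue (\<lambda>x. indicator (box a b) x *\<^sub>R (indicator (cbox a b) x *\<^sub>R w x))"
        using int[OF X(2)] by (rule integrable_mult_indicator[rotated]) auto
      also have "(\<lambda>x. indicator (box a b) x *\<^sub>R (indicator (cbox a b) x *\<^sub>R w x)) = F"
      proof
        fix x
        show "indicator (box a b) x *\<^sub>R (indicator (cbox a b) x *\<^sub>R w x) = F x"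
          using box_subset_cbox[of a b] by (cases "x \<in> box a b") (auto simp: F_def)
      qed
      finally show ?thesis .
    qed
    have "set_lebesgue_integral lebesgue (box c d) F = 0" for c d
    proof -
      obtain e f where ef: "box c d \<inter> box a b = box e f"
        using box_Int_box[of c d a b] that by blast
      have "set_lebesgue_integral lebesgue (box c d) F = set_lebesgue_integral lebesgue (box e f) w"
        unfolding set_lebesgue_integral_def F_def ef[symmetric]
        by (intro Bochner_Integration.integral_cong) (auto split: split_indicator)
      also have "\<dots> = 0"
      \<comment> \<open>An empty open box can have a nonempty closed counterpart outside
        \<open>cbox a b\<close>; only for a nonempty box does taking closures give the
        inclusion.\<close>
      proof (cases "box e f = {}")
        case False
        have "box e f \<subseteq> cbox a b"
          using ef box_subset_cbox[of a b] by blast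
        then have "closure (box e f) \<subseteq> closure (cbox a b)"
          by (rule closure_mono)
        then have "cbox e f \<subseteq> cbox a b"
          using False by (simp add: closure_box)
        then show ?thesis
          using X by (intro box) auto
      qed (simp add: set_lebesgue_integral_def)
      finally show ?thesis .
    qed
    then have "AE x in lebesgue. F x = 0"
      by (rule AE_zero_if_box_integrals_zero[OF F])
    \<comment> \<open>The cut-off F sees only the open box, whereas the cover consists of closed
      ones; the difference is a null set.\<close>
    moreover have "AE x in lebesgue. x \<notin> cbox a b - box a b"
    proof -
      have "cbox a b - box a b \<in> null_sets lebesgue"
        by (simp add: negligible_frontier_interval negligible_iff_null_sets[symmetric])
      then show ?thesis
        by (rule AE_not_in)
    qed
    ultimately show ?thesis
      by eventually_elim (auto simp: X F_def split: split_indicator_asm)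
  qed
  then have "AE x in lebesgue. \<forall>X\<in>D. x \<in> X \<longrightarrow> w x = 0"
    by (subst AE_ball_countable[OF D(1)]) blast
  then have "AE x in lebesgue. x \<in> \<Omega> \<longrightarrow> w x = 0"
    by eventually_elim (use D(4) in auto)
  then show ?thesis
    using \<Omega> by (simp add: AE_restrict_space_iff)
qed

section \<open>Integration by parts against compactly supported functions\<close>

lemma partial_outside_support:
  assumes "x \<notin> closure {x. g x \<noteq> 0}"
  shows "partial j g x = 0"
proof -
  have "(g has_derivative (\<lambda>h. 0)) (at x)"
  proof (rule has_derivative_transform_within_open[of "\<lambda>x. 0"])
    show "open (- closure {x. g x \<noteq> 0})" by auto
    show "0 = g y" if "y \<in> - closure {x. g x \<noteq> 0}" for y
      using that closure_subset[of "{x. g x \<noteq> 0}"] by auto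
  qed (use assms in auto)
  then show ?thesis by (rule partial_eq)
qed

lemma integrable_lborel_compact_support:
  fixes f :: "'a::euclidean_space \<Rightarrow> 'b::{banach, second_countable_topology}"
  assumes "continuous_on UNIV f" "compact K" "\<And>x. x \<notin> K \<Longrightarrow> f x = 0"
  shows "integrable lborel f"
proof -
  have "integrable lborel (\<lambda>x. indicator K x *\<^sub>R f x)"
    using assms by (intro borel_integrable_compact) (auto intro: continuous_on_subset)
  also have "(\<lambda>x. indicator K x *\<^sub>R f x) = f"
    using assms(3) by (auto split: split_indicator)
  finally show ?thesis .
qed

text \<open>The difference quotients have integral zero by translation invariance.\<close>

lemma integral_partial_eq_0:
  fixes g :: "real^'n \<Rightarrow> complex"
  assumes g: "\<And>x. g differentiable at x" and cont: "continuous_on UNIV (partial j g)"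
    and supp: "compact (closure {x. g x \<noteq> 0})"
  shows "(LINT x|lborel. partial j g x) = 0"
proof -
  define K where "K = closure {x. g x \<noteq> 0}"
  define e :: "real^'n" where "e = axis j 1"
  have e: "norm e = 1" by (simp add: e_def)
  have K: "compact K" "\<And>x. x \<notin> K \<Longrightarrow> g x = 0" "\<And>x. x \<notin> K \<Longrightarrow> partial j g x = 0"
    using supp closure_subset[of "{x. g x \<noteq> 0}"] partial_outside_support[of _ g] by (auto simp: K_def)
  have cg: "continuous_on UNIV g"
    using g by (auto intro!: continuous_at_imp_continuous_on differentiable_imp_continuous_within)
  have ig: "integrable lborel g"
    by (rule integrable_lborel_compact_support[OF cg K(1,2)])
  obtain C where C: "C \<ge> 0" "\<And>x. norm (partial j g x) \<le> C"
  proof -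
    have "bounded (partial j g ` K)"
      by (intro compact_imp_bounded compact_continuous_image K continuous_on_subset[OF cont]) auto
    then obtain C where "\<And>x. x \<in> K \<Longrightarrow> norm (partial j g x) \<le> C"
      by (auto simp: bounded_iff)
    then have "norm (partial j g x) \<le> max C 0" for x
      using K(3)[of x] by (cases "x \<in> K") (auto simp: max.coboundedI1)
    then show ?thesis by (intro that[of "max C 0"]) auto
  qed
  obtain R where R: "\<And>x. x \<in> K \<Longrightarrow> norm x \<le> R"
    using compact_imp_bounded[OF K(1)] by (auto simp: bounded_iff)
  have D: "((\<lambda>s. g (x + s *\<^sub>R e)) has_vector_derivative partial j g (x + s *\<^sub>R e)) (at s)" for x s
  proof -
    have "(g has_derivative frechet_derivative g (at (x + s *\<^sub>R e))) (at (x + s *\<^sub>R e))"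
      using g by (simp add: frechet_derivative_works)
    moreover have "((\<lambda>s. x + s *\<^sub>R e) has_vector_derivative e) (at s)"
      by (auto intro!: derivative_eq_intros)
    ultimately show ?thesis
      using vector_derivative_diff_chain_within[of "\<lambda>s. x + s *\<^sub>R e" e s UNIV g "frechet_derivative g (at (x + s *\<^sub>R e))"]
      by (simp add: has_derivative_at_withinI o_def partial_def e_def)
  qed
  have lip: "norm (g (x + h *\<^sub>R e) - g x) \<le> C * h" if "h \<ge> 0" for x h
  proof -
    have "norm (g (x + h *\<^sub>R e) - g (x + 0 *\<^sub>R e)) \<le> C * norm (h - 0)"
    proof (rule differentiable_bound[of "{0..h}" "\<lambda>s. g (x + s *\<^sub>R e)" "\<lambda>s t. t *\<^sub>R partial j g (x + s *\<^sub>R e)"])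
      show "((\<lambda>s. g (x + s *\<^sub>R e)) has_derivative (\<lambda>t. t *\<^sub>R partial j g (x + s *\<^sub>R e))) (at s within {0..h})" for s
        using D[of x s] by (auto simp: has_vector_derivative_def intro: has_derivative_at_withinI)
      show "onorm (\<lambda>t. t *\<^sub>R partial j g (x + s *\<^sub>R e)) \<le> C" for s
        using C by (intro onorm_bound) (auto simp: mult.commute[of C] intro: mult_left_mono)
    qed (use that in auto)
    then show ?thesis using that by simp
  qed
  define h where "h = (\<lambda>m. inverse (real (Suc m)))"
  have h: "h m > 0" "h m \<le> 1" "h \<longlonglongrightarrow> 0" for m
    using LIMSEQ_inverse_real_of_nat by (auto simp: h_def inverse_le_1_iff)
  let ?s = "\<lambda>m x. (g (x + h m *\<^sub>R e) - g x) /\<^sub>R h m"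
  have shift: "integrable lborel (\<lambda>x. g (x + v))" "(LINT x|lborel. g (x + v)) = (LINT x|lborel. g x)" for v
  proof -
    have m: "(+) v \<in> measurable lborel borel" "g \<in> borel_measurable borel"
      using ig by auto
    show "integrable lborel (\<lambda>x. g (x + v))"
      using integrable_distr_eq[OF m] ig by (simp add: lborel_distr_plus add.commute)
    show "(LINT x|lborel. g (x + v)) = (LINT x|lborel. g x)"
      using integral_distr[OF m] by (simp add: lborel_distr_plus add.commute)
  qed
  have "(\<lambda>m. LINT x|lborel. ?s m x) \<longlonglongrightarrow> (LINT x|lborel. partial j g x)"
  proof (rule integral_dominated_convergence)
    \<comment> \<open>All steps satisfy h <= 1, so every difference quotient vanishes outside the
      ball of radius R + 1, and the mean value bound \<open>lip\<close> dominates it by C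
      inside.\<close>
    show "integrable lborel (\<lambda>x. indicator (cball 0 (R + 1)) x *\<^sub>R C :: real)"
      by (intro borel_integrable_compact) auto
    show "AE x in lborel. (\<lambda>m. ?s m x) \<longlonglongrightarrow> partial j g x"
    proof (rule AE_I2)
      fix x
      have "((\<lambda>t. (g (x + t *\<^sub>R e) - g x) /\<^sub>R t) \<longlongrightarrow> partial j g x) (at 0)"
      proof (rule Lim_null[THEN iffD2], rule tendsto_norm_zero_cancel, rule Lim_transform_eventually)
        show "((\<lambda>t. norm (g (x + t *\<^sub>R e) - g x - t *\<^sub>R partial j g x) / norm t) \<longlongrightarrow> 0) (at 0)"
          using D[of x 0] by (simp add: has_vector_derivative_def has_derivative_at)
        show "\<forall>\<^sub>F t in at 0. norm (g (x + t *\<^sub>R e) - g x - t *\<^sub>R partial j g x) / norm t =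
            norm ((g (x + t *\<^sub>R e) - g x) /\<^sub>R t - partial j g x)"
        proof (rule eventually_at_filter[THEN iffD2], rule always_eventually, intro allI impI)
          fix t :: real assume t: "t \<noteq> 0"
          then have "(g (x + t *\<^sub>R e) - g x) /\<^sub>R t - partial j g x = (g (x + t *\<^sub>R e) - g x - t *\<^sub>R partial j g x) /\<^sub>R t"
            by (simp add: scaleR_diff_right)
          then show "norm (g (x + t *\<^sub>R e) - g x - t *\<^sub>R partial j g x) / norm t =
            norm ((g (x + t *\<^sub>R e) - g x) /\<^sub>R t - partial j g x)"
            by (simp add: divide_inverse mult.commute)
        qed
      qed
      then show "(\<lambda>m. ?s m x) \<longlonglongrightarrow> partial j g x"
        by (rule filterlim_compose) (use h in \<open>auto simp: filterlim_at intro!: always_eventually less_imp_neq[THEN not_sym]\<close>)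
    qed
    show "AE x in lborel. norm (?s m x) \<le> indicator (cball 0 (R + 1)) x *\<^sub>R C" for m
    proof (rule AE_I2)
      fix x
      show "norm (?s m x) \<le> indicator (cball 0 (R + 1)) x *\<^sub>R C"
      proof (cases "x \<in> cball 0 (R + 1)")
        case True
        then show ?thesis
          using lip[of "h m" x] h(1)[of m] by (simp add: divide_simps mult.commute flip: divide_inverse_commute)
      next
        case False
        have "norm (h m *\<^sub>R e) \<le> 1" using h(1,2)[of m] e by simp
        then have "x \<notin> K" "x + h m *\<^sub>R e \<notin> K"
          using R[of x] R[of "x + h m *\<^sub>R e"] False norm_triangle_ineq4[of "x + h m *\<^sub>R e" "h m *\<^sub>R e"] by auto
        then show ?thesis using K(2) C(1) by simp
      qed
    qed
    show "partial j g \<in> borel_measurable lborel"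
      using cont by (simp add: borel_measurable_continuous_onI)
    show "?s m \<in> borel_measurable lborel" for m
      using shift(1)[of "h m *\<^sub>R e"] ig by (intro borel_measurable_scaleR borel_measurable_diff) auto
  qed
  moreover have "(LINT x|lborel. ?s m x) = 0" for m
    using shift ig by simp
  ultimately show ?thesis
    by (simp only: LIMSEQ_const_iff)
qed

text \<open>The definitions integrate over \<Omega> with the completed measure; translation
  invariance is applied over the whole space with \<open>lborel\<close>. For Borel functions
  vanishing off \<Omega> the two agree.\<close>

lemma integral_lebesgue_on_eq_lborel:
  fixes f :: "'a::euclidean_space \<Rightarrow> 'b::{banach, second_countable_topology}"
  assumes "f \<in> borel_measurable borel" "\<Omega> \<in> sets lebesgue" "\<And>x. x \<notin> \<Omega> \<Longrightarrow> f x = 0"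
  shows "(LINT x|lebesgue_on \<Omega>. f x) = (LINT x|lborel. f x)"
    "integrable (lebesgue_on \<Omega>) f \<longleftrightarrow> integrable lborel f"
proof -
  have "(\<lambda>x. indicator \<Omega> x *\<^sub>R f x) = f"
    using assms(3) by (auto split: split_indicator)
  then show "(LINT x|lebesgue_on \<Omega>. f x) = (LINT x|lborel. f x)"
    "integrable (lebesgue_on \<Omega>) f \<longleftrightarrow> integrable lborel f"
    using assms by (simp_all add: integral_restrict_space integrable_restrict_space integral_completion integrable_completion)
qed

section \<open>The magnetic gradient of a smooth function\<close>

lemma L2_mult_integrable:
  fixes f g :: "'a::euclidean_space \<Rightarrow> complex"
  assumes "f \<in> L2 \<Omega>" "g \<in> L2 \<Omega>"
  shows "integrable (lebesgue_on \<Omega>) (\<lambda>x. f x * g x)"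
proof (rule Bochner_Integration.integrable_bound)
  show "integrable (lebesgue_on \<Omega>) (\<lambda>x. (norm (f x))\<^sup>2 + (norm (g x))\<^sup>2)"
    using assms by (auto simp: L2_def)
  show "(\<lambda>x. f x * g x) \<in> borel_measurable (lebesgue_on \<Omega>)"
    using assms by (auto simp: L2_def)
  have "a * b \<le> a\<^sup>2 + b\<^sup>2" if "a \<ge> 0" "b \<ge> 0" for a b :: real
    using mult_nonneg_nonneg[OF that] sum_squares_bound[of a b] by linarith
  then show "AE x in lebesgue_on \<Omega>. norm (f x * g x) \<le> norm ((norm (f x))\<^sup>2 + (norm (g x))\<^sup>2)"
    by (intro AE_I2) (simp add: norm_mult)
qed

lemma L2_cnj: "f \<in> L2 \<Omega> \<Longrightarrow> (\<lambda>x. cnj (f x)) \<in> L2 \<Omega>"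
proof -
  assume f: "f \<in> L2 \<Omega>"
  have "cnj \<in> borel_measurable borel"
    by (intro borel_measurable_continuous_onI continuous_intros)
  then show ?thesis using f by (auto simp: L2_def intro: measurable_compose)
qed

lemma L2_component:
  fixes v :: "'a::euclidean_space \<Rightarrow> complex^'n"
  assumes "v \<in> L2 \<Omega>" shows "(\<lambda>x. v x $ j) \<in> L2 \<Omega>"
proof -
  have "(\<lambda>y::complex^'n. y $ j) \<in> borel_measurable borel"
    by (intro borel_measurable_continuous_onI continuous_intros)
  then have m: "(\<lambda>x. v x $ j) \<in> borel_measurable (lebesgue_on \<Omega>)"
    using assms measurable_compose[of v "lebesgue_on \<Omega>" borel "\<lambda>y. y $ j" borel]
    by (simp add: L2_def)
  moreover have "integrable (lebesgue_on \<Omega>) (\<lambda>x. (norm (v x $ j))\<^sup>2)"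
  proof (rule Bochner_Integration.integrable_bound)
    show "integrable (lebesgue_on \<Omega>) (\<lambda>x. (norm (v x))\<^sup>2)"
      using assms by (simp add: L2_def)
    show "AE x in lebesgue_on \<Omega>. norm ((norm (v x $ j))\<^sup>2) \<le> norm ((norm (v x))\<^sup>2)"
      by (intro AE_I2) (simp add: Finite_Cartesian_Product.norm_nth_le power_mono)
  qed (use m in measurable)
  ultimately show ?thesis by (simp add: L2_def)
qed

text \<open>The indicator of a box is itself in L2, and a product of two L2 functions is integrable.
  This supplies the local integrability that \<open>fundamental_lemma\<close> asks for.\<close>

lemma L2_integrable_on_cbox:
  fixes f :: "'a::euclidean_space \<Rightarrow> complex"
  assumes "f \<in> L2 \<Omega>" "\<Omega> \<in> sets lebesgue" "cbox a b \<subseteq> \<Omega>"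
  shows "integrable lebesgue (\<lambda>x. indicator (cbox a b) x *\<^sub>R f x)"
proof -
  define K where "K = cbox a b"
  have K: "K \<subseteq> \<Omega>" "K \<in> sets lebesgue"
    using assms(3) by (auto simp: K_def)
  have "integrable lebesgue (indicator K :: 'a \<Rightarrow> real)"
    by (intro integrable_real_indicator) (auto simp: K_def emeasure_lborel_cbox_eq)
  also have "(indicator K :: 'a \<Rightarrow> real) = (\<lambda>x. indicator \<Omega> x *\<^sub>R (norm (indicator K x :: complex))\<^sup>2)"
    using K(1) by (auto simp: fun_eq_iff indicator_def)
  finally have "integrable (lebesgue_on \<Omega>) (\<lambda>x. (norm (indicator K x :: complex))\<^sup>2)"
    using assms(2) by (simp add: integrable_restrict_space)
  moreover have "(indicator K :: 'a \<Rightarrow> complex) \<in> borel_measurable (lebesgue_on \<Omega>)"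
    by (intro measurable_restrict_space1 borel_measurable_indicator K)
  ultimately have "(indicator K :: 'a \<Rightarrow> complex) \<in> L2 \<Omega>"
    by (simp add: L2_def)
  from L2_mult_integrable[OF assms(1) this]
  have "integrable lebesgue (\<lambda>x. indicator \<Omega> x *\<^sub>R (f x * indicator K x))"
    using assms(2) by (simp add: integrable_restrict_space)
  also have "(\<lambda>x. indicator \<Omega> x *\<^sub>R (f x * indicator K x)) = (\<lambda>x. indicator K x *\<^sub>R f x)"
    using K(1) by (auto simp: fun_eq_iff indicator_def)
  finally show ?thesis by (simp add: K_def)
qed

lemma test_function_continuous:
  assumes "\<phi> \<in> test_functions \<Omega>"
  shows "continuous_on UNIV \<phi>" "continuous_on UNIV (partial j \<phi>)" "\<phi> differentiable at x"
    "compact (closure {x. \<phi> x \<noteq> 0})" "x \<notin> closure {x. \<phi> x \<noteq> 0} \<Longrightarrow> \<phi> x = 0" "x \<notin> \<Omega> \<Longrightarrow> \<phi> x = 0"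
    "x \<notin> closure {x. \<phi> x \<noteq> 0} \<Longrightarrow> partial j \<phi> x = 0" "x \<notin> \<Omega> \<Longrightarrow> partial j \<phi> x = 0"
proof -
  have "Ck 0 \<phi>" "Ck (Suc 0) \<phi>"
    using assms unfolding test_functions_def by blast+
  then show "continuous_on UNIV \<phi>" "continuous_on UNIV (partial j \<phi>)" "\<phi> differentiable at x"
    by auto
  have sub: "closure {x. \<phi> x \<noteq> 0} \<subseteq> \<Omega>"
    using assms by (simp add: test_functions_def)
  have out: "\<phi> x = 0" if "x \<notin> closure {x. \<phi> x \<noteq> 0}" for x
    using that closure_subset[of "{x. \<phi> x \<noteq> 0}"] by blast
  show "compact (closure {x. \<phi> x \<noteq> 0})"
    using assms by (simp add: test_functions_def)
  show "x \<notin> closure {x. \<phi> x \<noteq> 0} \<Longrightarrow> \<phi> x = 0" "x \<notin> closure {x. \<phi> x \<noteq> 0} \<Longrightarrow> partial j \<phi> x = 0"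
    by (fact out, rule partial_outside_support)
  show "x \<notin> \<Omega> \<Longrightarrow> \<phi> x = 0" "x \<notin> \<Omega> \<Longrightarrow> partial j \<phi> x = 0"
    using out[of x] partial_outside_support[of x \<phi> j] sub by blast+
qed

lemma test_function_L2:
  fixes \<phi> :: "real^'n \<Rightarrow> complex"
  assumes "\<phi> \<in> test_functions \<Omega>" "\<Omega> \<in> sets lebesgue"
  shows "\<phi> \<in> L2 \<Omega>"
proof -
  note t = test_function_continuous[OF assms(1)]
  have "integrable lborel (\<lambda>x. (norm (\<phi> x))\<^sup>2)"
  proof (rule integrable_lborel_compact_support[OF _ t(4)])
    show "continuous_on UNIV (\<lambda>x. (norm (\<phi> x))\<^sup>2)"
      by (intro continuous_intros t(1))
  qed (drule t(5), simp)
  moreover have m: "\<phi> \<in> borel_measurable borel"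
    by (intro borel_measurable_continuous_onI t(1))
  have "integrable (lebesgue_on \<Omega>) (\<lambda>x. (norm (\<phi> x))\<^sup>2) \<longleftrightarrow> integrable lborel (\<lambda>x. (norm (\<phi> x))\<^sup>2)"
    by (rule integral_lebesgue_on_eq_lborel(2)) (use m assms(2) in \<open>simp_all add: t(6)\<close>)
  moreover have "\<phi> \<in> borel_measurable (lebesgue_on \<Omega>)"
    using m by (intro measurable_restrict_space1 measurable_completion) simp
  ultimately show ?thesis
    by (simp add: L2_def)
qed

text \<open>The integral of the partial derivative of u \<phi> vanishes because \<phi> has compact
  support; this moves the derivative from u to \<phi>, so the classical gradient is the
  distributional one.\<close>

lemma is_magnetic_gradient_C1:
  fixes u :: "real^3 \<Rightarrow> complex"
  assumes \<Omega>: "\<Omega> \<in> sets lebesgue" and A: "continuous_on UNIV A"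
    and u: "\<And>x. u differentiable at x" and du: "\<And>j. continuous_on UNIV (partial j u)"
  shows "is_magnetic_gradient A \<Omega> u (\<lambda>x. \<chi> j. - \<i> * partial j u x + of_real (A x $ j) * u x)"
  unfolding is_magnetic_gradient_def
proof (intro ballI allI)
  fix \<phi> :: "real^3 \<Rightarrow> complex" and j
  assume \<phi>: "\<phi> \<in> test_functions \<Omega>"
  note t = test_function_continuous[OF \<phi>]
  have cu: "continuous_on UNIV u"
    using u by (auto intro!: continuous_at_imp_continuous_on differentiable_imp_continuous_within)
  have cA: "continuous_on UNIV (\<lambda>x. complex_of_real (A x $ j))"
    by (intro continuous_intros A)
  let ?f = "\<lambda>x. (- \<i> * partial j u x + of_real (A x $ j) * u x) * \<phi> x"
  let ?g = "\<lambda>x. u x * (\<i> * partial j \<phi> x + of_real (A x $ j) * \<phi> x)"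
  have cf: "continuous_on UNIV ?f" and cg: "continuous_on UNIV ?g"
    by (intro continuous_intros du cu cA t(1) t(2))+
  have int: "integrable lborel ?f" "integrable lborel ?g"
    by (rule integrable_lborel_compact_support[OF cf t(4)], drule t(5), simp)
      (rule integrable_lborel_compact_support[OF cg t(4)], frule t(5), drule t(7)[where j = j], simp)
  have pm: "partial j (\<lambda>x. u x * \<phi> x) = (\<lambda>x. u x * partial j \<phi> x + partial j u x * \<phi> x)"
    by (intro ext partial_mult u t(3))
  have "(LINT x|lborel. partial j (\<lambda>x. u x * \<phi> x) x) = 0"
  proof (rule integral_partial_eq_0)
    have "closure {x. u x * \<phi> x \<noteq> 0} \<subseteq> closure {x. \<phi> x \<noteq> 0}"
      by (rule closure_mono) auto
    then show "compact (closure {x. u x * \<phi> x \<noteq> 0})"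
      using closed_Int_compact[OF closed_closure t(4), of "{x. u x * \<phi> x \<noteq> 0}"] by (simp only: Int_absorb2)
    show "(\<lambda>x. u x * \<phi> x) differentiable at x" for x
      by (intro differentiable_mult u t(3))
    show "continuous_on UNIV (partial j (\<lambda>x. u x * \<phi> x))"
      unfolding pm by (intro continuous_intros du cu t(1) t(2))
  qed
  then have "(LINT x|lborel. \<i> * partial j (\<lambda>x. u x * \<phi> x) x) = 0"
    by simp
  also have "(\<lambda>x. \<i> * partial j (\<lambda>x. u x * \<phi> x) x) = (\<lambda>x. ?g x - ?f x)"
    unfolding pm by (auto simp: algebra_simps)
  finally have "(LINT x|lborel. ?g x) = (LINT x|lborel. ?f x)"
    using int by simp
  moreover have "(LINT x|lebesgue_on \<Omega>. ?f x) = (LINT x|lborel. ?f x)"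
    by (rule integral_lebesgue_on_eq_lborel(1)) (rule borel_measurable_continuous_onI[OF cf], rule \<Omega>, simp add: t(6))
  moreover have "(LINT x|lebesgue_on \<Omega>. ?g x) = (LINT x|lborel. ?g x)"
    by (rule integral_lebesgue_on_eq_lborel(1)) (rule borel_measurable_continuous_onI[OF cg], rule \<Omega>, simp add: t(6) t(8))
  ultimately show "(LINT x|lebesgue_on \<Omega>. (\<chi> j. - \<i> * partial j u x + of_real (A x $ j) * u x) $ j * \<phi> x) =
      (LINT x|lebesgue_on \<Omega>. u x * (\<i> * partial j \<phi> x + of_real (A x $ j) * \<phi> x))"
    by simp
qed

text \<open>\<open>magnetic_gradient\<close> is an arbitrary choice among the L2 gradients. Two of
  them have the same pairings with all test functions, hence agree almost everywhere, so the form
  may be evaluated on any gradient that is known explicitly.\<close>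

lemma magnetic_form_eq:
  assumes "open \<Omega>" and v: "v \<in> L2 \<Omega>" "is_magnetic_gradient A \<Omega> u v"
  shows "magnetic_form A \<Omega> u = L2_normsq \<Omega> v"
proof -
  define w where "w = magnetic_gradient A \<Omega> u"
  have \<Omega>: "\<Omega> \<in> sets lebesgue"
    using \<open>open \<Omega>\<close> by (intro sets_completionI_sets) auto
  have w: "w \<in> L2 \<Omega>" "is_magnetic_gradient A \<Omega> u w"
    unfolding w_def magnetic_gradient_def
    using someI[of "\<lambda>v. v \<in> L2 \<Omega> \<and> is_magnetic_gradient A \<Omega> u v" v] v by auto
  have "AE x in lebesgue_on \<Omega>. w x $ j - v x $ j = 0" for j
  proof (rule fundamental_lemma[OF \<open>open \<Omega>\<close>])
    note c = L2_component[OF w(1), of j] L2_component[OF v(1), of j]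
    show "integrable lebesgue (\<lambda>x. indicator (cbox a b) x *\<^sub>R (w x $ j - v x $ j))" if "cbox a b \<subseteq> \<Omega>" for a b
      using c[THEN L2_integrable_on_cbox, OF \<Omega> that] by (simp add: scaleR_diff_right)
    fix \<phi> :: "real^3 \<Rightarrow> complex"
    assume \<phi>: "\<phi> \<in> test_functions \<Omega>"
    then have "(LINT x|lebesgue_on \<Omega>. w x $ j * \<phi> x) = (LINT x|lebesgue_on \<Omega>. v x $ j * \<phi> x)"
      using v(2) w(2) by (simp add: is_magnetic_gradient_def)
    then show "(LINT x|lebesgue_on \<Omega>. (w x $ j - v x $ j) * \<phi> x) = 0"
      using c[THEN L2_mult_integrable, OF test_function_L2[OF \<phi> \<Omega>]] by (simp add: left_diff_distrib)
  qed
  then have "AE x in lebesgue_on \<Omega>. \<forall>j\<in>UNIV. w x $ j - v x $ j = 0"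
    by (subst AE_finite_all) auto
  then have "AE x in lebesgue_on \<Omega>. w x = v x"
    by eventually_elim (auto simp: vec_eq_iff)
  then have "L2_normsq \<Omega> w = L2_normsq \<Omega> v"
    unfolding L2_normsq_def using w(1) v(1)
    by (intro integral_cong_AE) (auto simp: L2_def)
  then show ?thesis by (simp add: magnetic_form_def w_def)
qed

section \<open>Integration over a cone\<close>

lemma Basis_vec_real: "(Basis :: (real^'n) set) = range (\<lambda>i. axis i 1)"
  by (auto simp: Basis_vec_def)

lemma prod_Basis_vec:
  "(\<Prod>b\<in>(Basis :: (real^'n) set). f b) = (\<Prod>i\<in>UNIV. f (axis i 1))"
  unfolding Basis_vec_real by (subst prod.reindex) (auto simp: inj_on_def axis_eq_axis)

lemma box_vec_3:
  "box l u = {x::real^3. x $ 1 \<in> {l $ 1<..<u $ 1} \<and> x $ 2 \<in> {l $ 2<..<u $ 2} \<and> x $ 3 \<in> {l $ 3<..<u $ 3}}"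
  by (auto simp: mem_box_cart forall_3)

lemma continuous_on_vector_3 [continuous_intros]:
  assumes "continuous_on S f" "continuous_on S g" "continuous_on S h"
  shows "continuous_on S (\<lambda>x. vector [f x, g x, h x] :: real^3)"
proof -
  have "(\<lambda>x. vector [f x, g x, h x] :: real^3) = (\<lambda>x. \<chi> i. if i = 1 then f x else if i = 2 then g x else h x)"
    by (auto simp: vec_eq_iff forall_3)
  moreover have "continuous_on S (\<lambda>x. if i = 1 then f x else if i = 2 then g x else h x)" for i :: 3
    using assms by (cases "i = 1"; cases "i = 2") auto
  ultimately show ?thesis
    by (simp only: continuous_on_vec_lambda)
qed

lemma continuous_on_vector_2 [continuous_intros]:
  assumes "continuous_on S f" "continuous_on S g"
  shows "continuous_on S (\<lambda>x. vector [f x, g x] :: real^2)"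
proof -
  have "(\<lambda>x. vector [f x, g x] :: real^2) = (\<lambda>x. \<chi> i. if i = 1 then f x else g x)"
    by (auto simp: vec_eq_iff forall_2)
  moreover have "continuous_on S (\<lambda>x. if i = 1 then f x else g x)" for i :: 2
    using assms by (cases "i = 1") auto
  ultimately show ?thesis
    by (simp only: continuous_on_vec_lambda)
qed

text \<open>Splits off the third coordinate, the cone axis, so that horizontal slices can be treated
  by Fubini.\<close>

lemma lborel_vec_3:
  "lborel = distr (lborel \<Otimes>\<^sub>M lborel :: (real \<times> (real^2)) measure) borel (\<lambda>(t, y). vector [y $ 1, y $ 2, t] :: real^3)"
    (is "_ = distr _ _ ?T")
proof (rule lborel_eqI)
  have T: "?T \<in> measurable (lborel \<Otimes>\<^sub>M lborel) borel"
    unfolding lborel_prod case_prod_beta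
    by (simp, intro borel_measurable_continuous_onI continuous_intros)
  fix l u :: "real^3"
  assume lu: "\<And>b. b \<in> Basis \<Longrightarrow> l \<bullet> b \<le> u \<bullet> b"
  have le: "l $ i \<le> u $ i" for i
    using lu[of "axis i 1"] by (simp add: inner_axis)
  have "?T -` box l u \<inter> space (lborel \<Otimes>\<^sub>M lborel) =
      {l $ 3<..<u $ 3} \<times> box (vector [l $ 1, l $ 2]) (vector [u $ 1, u $ 2])"
    by (auto simp: box_vec_3 mem_box_cart forall_2 space_pair_measure)
  then have "emeasure (distr (lborel \<Otimes>\<^sub>M lborel) borel ?T) (box l u) =
     emeasure lborel {l $ 3<..<u $ 3} * emeasure lborel (box (vector [l $ 1, l $ 2]) (vector [u $ 1, u $ 2] :: real^2))"
    by (simp add: emeasure_distr[OF T] lborel.emeasure_pair_measure_Times)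
  also have "emeasure lborel (box (vector [l $ 1, l $ 2]) (vector [u $ 1, u $ 2] :: real^2)) =
      ennreal ((u $ 1 - l $ 1) * (u $ 2 - l $ 2))"
  proof (subst emeasure_lborel_box)
    show "vector [l $ 1, l $ 2] \<bullet> b \<le> (vector [u $ 1, u $ 2] :: real^2) \<bullet> b" if "b \<in> Basis" for b
      using that le by (auto simp: Basis_vec_real UNIV_2 inner_axis)
  qed (simp add: prod_Basis_vec UNIV_2 inner_axis)
  also have "emeasure lborel {l $ 3<..<u $ 3} * \<dots> = ennreal (\<Prod>b\<in>Basis. (u - l) \<bullet> b)"
  proof -
    have "emeasure lborel {l $ 3<..<u $ 3} = ennreal (u $ 3 - l $ 3)"
      using le by simp
    moreover have "(\<Prod>b\<in>Basis. (u - l) \<bullet> b) = (u $ 3 - l $ 3) * ((u $ 1 - l $ 1) * (u $ 2 - l $ 2))"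
      unfolding prod_Basis_vec UNIV_3 by (simp add: inner_axis)
    ultimately show ?thesis
      by (simp only: ennreal_mult[OF diff_ge_0_iff_ge[THEN iffD2, OF le] mult_nonneg_nonneg[OF diff_ge_0_iff_ge[THEN iffD2, OF le] diff_ge_0_iff_ge[THEN iffD2, OF le]]])
  qed
  finally show "emeasure (distr (lborel \<Otimes>\<^sub>M lborel) borel ?T) (box l u) = ennreal (\<Prod>b\<in>Basis. (u - l) \<bullet> b)" .
qed simp

lemma open_cone_over:
  assumes "open \<omega>" shows "open (cone_over \<omega>)"
proof -
  have "open {x::real^3. x $ 3 > 0}"
    by (intro open_Collect_less continuous_intros)
  moreover have "continuous_on {x::real^3. x $ 3 > 0} (\<lambda>x. vector [x $ 1 / x $ 3, x $ 2 / x $ 3] :: real^2)"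
    by (intro continuous_intros) auto
  ultimately have "open ((\<lambda>x. vector [x $ 1 / x $ 3, x $ 2 / x $ 3] :: real^2) -` \<omega> \<inter> {x::real^3. x $ 3 > 0})"
    using assms continuous_on_open_vimage[of "{x::real^3. x $ 3 > 0}"] by blast
  also have "(\<lambda>x. vector [x $ 1 / x $ 3, x $ 2 / x $ 3] :: real^2) -` \<omega> \<inter> {x::real^3. x $ 3 > 0} = cone_over \<omega>"
    by (auto simp: cone_over_def)
  finally show ?thesis .
qed

definition cone_map :: "real \<times> (real^2) \<Rightarrow> real^3" where
  "cone_map = (\<lambda>(t, y). vector [t * y $ 1, t * y $ 2, t])"

lemma cone_map_measurable [measurable]: "cone_map \<in> borel_measurable borel"
  unfolding cone_map_def case_prod_beta by (intro borel_measurable_continuous_onI continuous_intros)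

lemma cone_map_in_cone:
  assumes "t > 0" shows "cone_map (t, y) \<in> cone_over \<omega> \<longleftrightarrow> y \<in> \<omega>"
proof -
  have "vector [y $ 1, y $ 2] = y" by (simp add: vec_eq_iff forall_2)
  then show ?thesis using assms by (simp add: cone_map_def cone_over_def)
qed

text \<open>The slice of the cone at height t > 0 is \<omega> scaled by t, and scaling the plane by
  t multiplies area by t^2; this replaces a Jacobian computation. An equality of measures transfers
  integrability and the value of the integral together.\<close>

lemma distr_cone_map:
  assumes "open \<omega>"
  shows "distr (density (lborel \<Otimes>\<^sub>M lborel) (\<lambda>(t, y). ennreal (indicator {0<..} t * t\<^sup>2 * indicator \<omega> y))) borel cone_map
    = density lborel (\<lambda>x. ennreal (indicator (cone_over \<omega>) x))"
    (is "distr (density _ ?d) _ _ = _")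
proof (rule measure_eqI)
  have [measurable]: "\<omega> \<in> sets borel" "cone_over \<omega> \<in> sets borel"
    using assms open_cone_over by auto
  have cm[measurable]: "cone_map \<in> measurable (lborel \<Otimes>\<^sub>M lborel) borel"
    by (simp add: lborel_prod)
  define T where "T = (\<lambda>(t, y :: real^2). vector [y $ 1, y $ 2, t] :: real^3)"
  have T[measurable]: "T \<in> measurable (lborel \<Otimes>\<^sub>M lborel) borel"
    unfolding lborel_prod case_prod_beta T_def
    by (simp, intro borel_measurable_continuous_onI continuous_intros)
  fix A assume "A \<in> sets (distr (density (lborel \<Otimes>\<^sub>M lborel) ?d) borel cone_map)"
  then have A[measurable]: "A \<in> sets borel" by simp
  define G where "G = (\<lambda>x. indicator (cone_over \<omega>) x * indicator A x :: ennreal)"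
  have G[measurable]: "G \<in> borel_measurable borel" by (simp add: G_def)
  have slice: "(\<integral>\<^sup>+y. G (T (t, y)) \<partial>lborel) =
      (\<integral>\<^sup>+y. ennreal (indicator {0<..} t * t\<^sup>2) * (indicator \<omega> y * indicator A (cone_map (t, y))) \<partial>lborel)" for t
  proof (cases "t > 0")
    case True
    have m: "(\<lambda>y. T (t, y)) \<in> measurable borel borel"
      unfolding T_def by (simp, intro borel_measurable_continuous_onI continuous_intros)
    then have m: "(\<lambda>y. G (T (t, y))) \<in> borel_measurable borel" by measurable
    have "(\<integral>\<^sup>+y. G (T (t, y)) \<partial>lborel) = (\<integral>\<^sup>+y. ennreal (t\<^sup>2) * G (T (t, t *\<^sub>R y)) \<partial>lborel)"
      using True m by (subst lborel_affine[of t 0]) (simp_all add: nn_integral_density nn_integral_distr ennreal_power)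
    also have "(\<lambda>y. G (T (t, t *\<^sub>R y))) = (\<lambda>y. indicator \<omega> y * indicator A (cone_map (t, y)))"
      using cone_map_in_cone[OF True, of _ \<omega>] by (auto simp: fun_eq_iff G_def T_def cone_map_def indicator_def)
    finally show ?thesis using True by simp
  qed (simp add: G_def T_def cone_over_def indicator_def)
  have "emeasure (density lborel (\<lambda>x. ennreal (indicator (cone_over \<omega>) x))) A = (\<integral>\<^sup>+x. G x \<partial>lborel)"
    by (simp add: emeasure_density G_def ennreal_indicator)
  also have "\<dots> = (\<integral>\<^sup>+p. G (T p) \<partial>(lborel \<Otimes>\<^sub>M lborel))"
    by (subst lborel_vec_3) (simp add: nn_integral_distr T_def[symmetric])
  also have "\<dots> = (\<integral>\<^sup>+t. \<integral>\<^sup>+y. G (T (t, y)) \<partial>lborel \<partial>lborel)"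
    by (rule lborel.nn_integral_fst[symmetric]) simp
  also have "\<dots> = (\<integral>\<^sup>+t. \<integral>\<^sup>+y. ennreal (indicator {0<..} t * t\<^sup>2) * (indicator \<omega> y * indicator A (cone_map (t, y))) \<partial>lborel \<partial>lborel)"
    by (simp only: slice)
  also have "\<dots> = (\<integral>\<^sup>+p. ennreal (indicator {0<..} (fst p) * (fst p)\<^sup>2) * (indicator \<omega> (snd p) * indicator A (cone_map p)) \<partial>(lborel \<Otimes>\<^sub>M lborel))"
    by (subst lborel.nn_integral_fst[symmetric]) simp_all
  also have "\<dots> = (\<integral>\<^sup>+p. ?d p * indicator A (cone_map p) \<partial>(lborel \<Otimes>\<^sub>M lborel))"
    by (intro nn_integral_cong) (auto split: split_indicator)
  also have "\<dots> = emeasure (distr (density (lborel \<Otimes>\<^sub>M lborel) ?d) borel cone_map) A"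
  proof -
    have "cone_map -` A \<inter> space (lborel \<Otimes>\<^sub>M lborel) \<in> sets (lborel \<Otimes>\<^sub>M lborel)"
      by (rule measurable_sets[OF cm A])
    then have "cone_map -` A \<in> sets (lborel \<Otimes>\<^sub>M lborel)"
      by (simp add: space_pair_measure)
    moreover have "?d \<in> borel_measurable (lborel \<Otimes>\<^sub>M lborel)"
      by measurable
    moreover have "indicator A (cone_map p) = (indicator (cone_map -` A) p :: ennreal)" for p
      by (simp add: indicator_def)
    ultimately show ?thesis
      by (simp add: emeasure_distr emeasure_density space_pair_measure)
  qed
  finally show "emeasure (distr (density (lborel \<Otimes>\<^sub>M lborel) ?d) borel cone_map) A =
     emeasure (density lborel (\<lambda>x. ennreal (indicator (cone_over \<omega>) x))) A" by simp
qed simp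

lemma integral_pair_mult:
  fixes f :: "'a \<Rightarrow> real" and g :: "'b \<Rightarrow> real"
  assumes "sigma_finite_measure M" "sigma_finite_measure N" "integrable M f" "integrable N g"
  shows "integrable (M \<Otimes>\<^sub>M N) (\<lambda>(x, y). f x * g y)"
    "(LINT p|(M \<Otimes>\<^sub>M N). (case p of (x, y) \<Rightarrow> f x * g y)) = (LINT x|M. f x) * (LINT y|N. g y)"
proof -
  interpret M: sigma_finite_measure M by fact
  interpret N: sigma_finite_measure N by fact
  interpret pair_sigma_finite M N ..
  have [measurable]: "f \<in> borel_measurable M" "g \<in> borel_measurable N"
    using assms by auto
  show i: "integrable (M \<Otimes>\<^sub>M N) (\<lambda>(x, y). f x * g y)"
    by (rule Fubini_integrable) (use assms in \<open>auto simp: abs_mult\<close>)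
  show "(LINT p|(M \<Otimes>\<^sub>M N). (case p of (x, y) \<Rightarrow> f x * g y)) = (LINT x|M. f x) * (LINT y|N. g y)"
    using integral_fst'[OF i] by simp
qed

text \<open>The integrand has to separate into g(t) P(y) only over the cone itself, since the
  density of the pulled-back measure vanishes elsewhere.\<close>

lemma cone_integral:
  fixes F :: "real^3 \<Rightarrow> real"
  assumes "open \<omega>" and F: "F \<in> borel_measurable borel"
    and eq: "\<And>t y. t > 0 \<Longrightarrow> y \<in> \<omega> \<Longrightarrow> F (cone_map (t, y)) = g t * P y"
    and g: "integrable lborel (\<lambda>t. indicator {0<..} t * t\<^sup>2 * g t)" and P: "integrable lborel (\<lambda>y. indicator \<omega> y * P y)"
  shows "integrable (lebesgue_on (cone_over \<omega>)) F"
    "(LINT x|lebesgue_on (cone_over \<omega>). F x) =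
      (LINT t|lborel. indicator {0<..} t * t\<^sup>2 * g t) * (LINT y|lborel. indicator \<omega> y * P y)"
proof -
  have b[measurable]: "\<omega> \<in> sets borel" "cone_over \<omega> \<in> sets borel"
    using assms open_cone_over by auto
  have [measurable]: "cone_map \<in> measurable (lborel \<Otimes>\<^sub>M lborel) borel"
    by (simp add: lborel_prod)
  note F[measurable]
  let ?d = "\<lambda>p. indicator {0<..} (fst p) * (fst p)\<^sup>2 * indicator \<omega> (snd p) :: real"
  have d: "distr (density (lborel \<Otimes>\<^sub>M lborel) (\<lambda>p. ennreal (?d p))) borel cone_map
    = density lborel (\<lambda>x. ennreal (indicator (cone_over \<omega>) x))"
    using distr_cone_map[OF assms(1)] by (simp add: case_prod_unfold)
  let ?h = "\<lambda>(t, y). (indicator {0<..} t * t\<^sup>2 * g t) * (indicator \<omega> y * P y)"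
  have h: "?d p *\<^sub>R F (cone_map p) = ?h p" for p
    using eq[of "fst p" "snd p"] by (auto simp: case_prod_beta split: split_indicator)
  note ip = integral_pair_mult[OF sigma_finite_lborel sigma_finite_lborel g P]
  have i1: "integrable (density lborel (\<lambda>x. ennreal (indicator (cone_over \<omega>) x))) F"
    unfolding d[symmetric] using ip(1)
    by (simp add: integrable_distr_eq integrable_density h[unfolded real_scaleR_def])
  have "(LINT x|density lborel (\<lambda>x. ennreal (indicator (cone_over \<omega>) x)). F x) =
      (LINT t|lborel. indicator {0<..} t * t\<^sup>2 * g t) * (LINT y|lborel. indicator \<omega> y * P y)"
    unfolding d[symmetric] using ip(2)
    by (simp add: integral_distr integral_density h[unfolded real_scaleR_def])
  then have "(LINT x|lborel. indicator (cone_over \<omega>) x * F x) = 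
      (LINT t|lborel. indicator {0<..} t * t\<^sup>2 * g t) * (LINT y|lborel. indicator \<omega> y * P y)"
    by (simp add: integral_density)
  moreover have "integrable lborel (\<lambda>x. indicator (cone_over \<omega>) x * F x)"
    using i1 by (simp add: integrable_density)
  ultimately show "integrable (lebesgue_on (cone_over \<omega>)) F"
    "(LINT x|lebesgue_on (cone_over \<omega>). F x) =
      (LINT t|lborel. indicator {0<..} t * t\<^sup>2 * g t) * (LINT y|lborel. indicator \<omega> y * P y)"
    using b(2) by (simp_all add: integrable_restrict_space integral_restrict_space integral_completion
        integrable_completion sets_completionI_sets)
qed

section \<open>Trial functions\<close>

text \<open>A vanishing integral would force the weight to vanish almost everywhere on t >= 0, but a
  nonzero polynomial in t^2 has only finitely many zeros there.\<close>

lemma gauss_functional_pos: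
  assumes c: "c > 0" and r: "r \<noteq> 0" "\<And>s. s \<ge> 0 \<Longrightarrow> poly r s \<ge> 0"
  shows "gauss_functional c r > 0"
proof (rule ccontr)
  assume "\<not> gauss_functional c r > 0"
  then have "(LINT t|lborel. gauss_weight c r t) = 0"
    using gauss_functional_nonneg[of r c, OF r(2)] by (simp add: gauss_functional_def)
  moreover have "AE t in lborel. gauss_weight c r t \<ge> 0"
    using r(2) by (intro AE_I2) (simp add: gauss_weight_def)
  ultimately have "AE t in lborel. gauss_weight c r t = 0"
    using integral_nonneg_eq_0_iff_AE integrable_gauss_weight[OF c] by blast
  moreover have "AE t in lborel. t \<notin> sqrt ` {s. poly r s = 0}"
    using poly_roots_finite[OF r(1)]
    by (intro AE_not_in finite_imp_null_set_lborel) auto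
  ultimately have "AE t in lborel. (t::real) \<notin> {0..1}"
  proof eventually_elim
    case (elim t)
    then show ?case
      by (auto simp: gauss_weight_def image_iff intro: real_sqrt_abs[symmetric] split: split_indicator_asm)
  qed
  then have "{0..1::real} \<in> null_sets lborel"
    by (subst (asm) AE_iff_null_sets[symmetric]) auto
  then show False by (simp add: null_sets_def)
qed

text \<open>The exponent is halved so that a product of two such functions carries exp(-c t^2), the
  weight of \<open>gauss_functional\<close>.\<close>

definition gauss_poly :: "real \<Rightarrow> real poly \<Rightarrow> real \<Rightarrow> real" where
  "gauss_poly c p t = exp (- c * t\<^sup>2 / 2) * poly p (t\<^sup>2)"

definition gauss_poly_deriv :: "real \<Rightarrow> real poly \<Rightarrow> real \<Rightarrow> real" where
  "gauss_poly_deriv c p t = t * gauss_poly c (smult 2 (pderiv p) - smult c p) t"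

lemma gauss_poly_has_derivative:
  "(gauss_poly c p has_real_derivative gauss_poly_deriv c p t) (at t)"
proof -
  have "((\<lambda>t. exp (- c * t\<^sup>2 / 2)) has_real_derivative exp (- c * t\<^sup>2 / 2) * (- c * t)) (at t)"
    by (auto intro!: derivative_eq_intros)
  moreover have "((\<lambda>t. poly p (t\<^sup>2)) has_real_derivative poly (pderiv p) (t\<^sup>2) * (2 * t)) (at t)"
    by (rule DERIV_chain2[OF poly_DERIV]) (auto intro!: derivative_eq_intros)
  ultimately have "((\<lambda>t. exp (- c * t\<^sup>2 / 2) * poly p (t\<^sup>2)) has_real_derivative
      exp (- c * t\<^sup>2 / 2) * (- c * t) * poly p (t\<^sup>2) + poly (pderiv p) (t\<^sup>2) * (2 * t) * exp (- c * t\<^sup>2 / 2)) (at t)"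
    by (rule DERIV_mult)
  then show ?thesis
    unfolding gauss_poly_def[abs_def] gauss_poly_deriv_def by (simp add: algebra_simps)
qed

lemma continuous_on_gauss_poly:
  assumes "continuous_on S f"
  shows "continuous_on S (\<lambda>x. gauss_poly c p (f x))" "continuous_on S (\<lambda>x. gauss_poly_deriv c p (f x))"
proof -
  have *: "continuous_on S (\<lambda>x. gauss_poly c p (f x))" for p
    using continuous_on_compose2[OF DERIV_continuous_on[OF gauss_poly_has_derivative] assms] by auto
  show "continuous_on S (\<lambda>x. gauss_poly c p (f x))" "continuous_on S (\<lambda>x. gauss_poly_deriv c p (f x))"
    unfolding gauss_poly_deriv_def by (intro * continuous_on_mult assms)+
qed

lemma gauss_poly_mult: "gauss_poly c p t * gauss_poly c q t = exp (- c * t\<^sup>2) * poly (p * q) (t\<^sup>2)"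
proof -
  have "exp (- c * t\<^sup>2) = exp (- c * t\<^sup>2 / 2) * exp (- c * t\<^sup>2 / 2)"
    by (simp add: mult_exp_exp)
  then show ?thesis
    unfolding gauss_poly_def poly_mult by algebra
qed

text \<open>When the linear map a - A is symmetric, this quadratic form is a primitive of it: its
  gradient is a - A.\<close>

definition potential_gap :: "(real^3 \<Rightarrow> real^3) \<Rightarrow> (real^3 \<Rightarrow> real^3) \<Rightarrow> real^3 \<Rightarrow> real" where
  "potential_gap a A x = (x \<bullet> (a x - A x)) / 2"

text \<open>The polynomials \<open>p\<close> and \<open>q\<close> are the real and imaginary parts of one complex polynomial; the phase
  replaces the potential \<open>A\<close> by \<open>a\<close>.\<close>

definition trial ::
  "(real^3 \<Rightarrow> real^3) \<Rightarrow> (real^3 \<Rightarrow> real^3) \<Rightarrow> real \<Rightarrow> real poly \<Rightarrow> real poly \<Rightarrow> real^3 \<Rightarrow> complex" where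
  "trial a A c p q x = exp (\<i> * of_real (potential_gap a A x)) *
     (of_real (gauss_poly c p (x $ 3)) + \<i> * of_real (gauss_poly c q (x $ 3)))"

text \<open>For linear \<open>a\<close> and \<open>A\<close>, the assumption \<open>sym\<close> says
  that the matrix of a - A is symmetric, that is, that both potentials have the same curl.\<close>

locale cone_trial =
  fixes \<omega> :: "(real^2) set" and a A :: "real^3 \<Rightarrow> real^3" and c :: real
  assumes \<omega>: "open \<omega>" "bounded \<omega>" "\<omega> \<noteq> {}" and A: "linear A" and a: "linear a"
    and sym: "\<And>x h. h \<bullet> (a x - A x) = x \<bullet> (a h - A h)"
    and c: "c > 0"
begin

lemma potential_gap_has_derivative:
  "(potential_gap a A has_derivative (\<lambda>h. h \<bullet> (a x - A x))) (at x)"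
proof -
  have d: "((\<lambda>x. a x - A x) has_derivative (\<lambda>h. a h - A h)) (at x)"
    using a A by (intro has_derivative_diff bounded_linear_imp_has_derivative) (simp_all add: linear_conv_bounded_linear)
  have "((\<lambda>x. (x \<bullet> (a x - A x)) / 2) has_derivative (\<lambda>h. (x \<bullet> (a h - A h) + h \<bullet> (a x - A x)) / 2)) (at x)"
    using has_derivative_mult_right[OF has_derivative_inner[OF has_derivative_ident d], of "1/2"] by simp
  then show ?thesis
    unfolding potential_gap_def[abs_def] sym[of x] by simp
qed

lemma trial_has_derivative:
  "(trial a A c p q has_derivative (\<lambda>h. exp (\<i> * of_real (potential_gap a A x)) *
     (\<i> * of_real (h \<bullet> (a x - A x)) * (of_real (gauss_poly c p (x $ 3)) + \<i> * of_real (gauss_poly c q (x $ 3))) +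
      of_real (h $ 3) * (of_real (gauss_poly_deriv c p (x $ 3)) + \<i> * of_real (gauss_poly_deriv c q (x $ 3)))))) (at x)"
proof -
  have 1: "((\<lambda>x. exp (\<i> * of_real (potential_gap a A x))) has_derivative
      (\<lambda>h. exp (\<i> * of_real (potential_gap a A x)) * (\<i> * of_real (h \<bullet> (a x - A x))))) (at x)"
    by (rule has_derivative_compose[OF _ DERIV_exp[unfolded has_field_derivative_def]])
      (intro has_derivative_mult_right has_derivative_of_real potential_gap_has_derivative)
  have 2: "((\<lambda>x::real^3. gauss_poly c r (x $ 3)) has_derivative (\<lambda>h. h $ 3 * gauss_poly_deriv c r (x $ 3))) (at x)" for r
    by (rule DERIV_compose_FDERIV[OF gauss_poly_has_derivative]) (auto intro!: bounded_linear_imp_has_derivative bounded_linear_vec_nth)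
  show ?thesis
    unfolding trial_def[abs_def]
    by (rule has_derivative_eq_rhs[OF has_derivative_mult[OF 1 has_derivative_add[OF has_derivative_of_real[OF 2]
        has_derivative_mult_right[OF has_derivative_of_real[OF 2]]]]])
      (simp only: of_real_mult distrib_left distrib_right mult.assoc mult.left_commute mult.commute add_ac)
qed

lemmas continuous_potentials [continuous_intros] =
  linear_continuous_on_compose[OF _ a] linear_continuous_on_compose[OF _ A]

lemma axis_nth_3: "axis j (1::real) $ 3 = (if j = 3 then 1 else (0::real))"
  by (simp add: axis_def)

lemma partial_trial:
  "partial j (trial a A c p q) = (\<lambda>x. exp (\<i> * of_real (potential_gap a A x)) *
     (\<i> * of_real ((a x - A x) $ j) * (of_real (gauss_poly c p (x $ 3)) + \<i> * of_real (gauss_poly c q (x $ 3))) +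
      of_real (if j = 3 then 1 else 0) * (of_real (gauss_poly_deriv c p (x $ 3)) + \<i> * of_real (gauss_poly_deriv c q (x $ 3)))))"
proof
  fix x
  have "axis j 1 \<bullet> (a x - A x) = (a x - A x) $ j"
    by (simp add: inner_axis')
  then show "partial j (trial a A c p q) x = exp (\<i> * of_real (potential_gap a A x)) *
     (\<i> * of_real ((a x - A x) $ j) * (of_real (gauss_poly c p (x $ 3)) + \<i> * of_real (gauss_poly c q (x $ 3))) +
      of_real (if j = 3 then 1 else 0) * (of_real (gauss_poly_deriv c p (x $ 3)) + \<i> * of_real (gauss_poly_deriv c q (x $ 3))))"
    unfolding partial_eq[OF trial_has_derivative] axis_nth_3 by (simp only:)
qed

definition trial_gradient :: "real poly \<Rightarrow> real poly \<Rightarrow> real^3 \<Rightarrow> complex^3" where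
  "trial_gradient p q x = (\<chi> j. - \<i> * partial j (trial a A c p q) x + of_real (A x $ j) * trial a A c p q x)"

text \<open>The phase \<theta> has gradient a - A, so (-i grad + A)(e^(i \<theta>) f) = e^(i
  \<theta>) (-i grad + a) f. Since f depends on x_3 alone, its derivative enters only the third
  component, where -i (P' + i Q') = Q' - i P'.\<close>

lemma trial_gradient_nth:
  "trial_gradient p q x $ j = exp (\<i> * of_real (potential_gap a A x)) *
     Complex (a x $ j * gauss_poly c p (x $ 3) + (if j = 3 then gauss_poly_deriv c q (x $ 3) else 0))
             (a x $ j * gauss_poly c q (x $ 3) - (if j = 3 then gauss_poly_deriv c p (x $ 3) else 0))"
proof -
  have "exp (\<i> * of_real (potential_gap a A x)) * (- \<i> * (\<i> * of_real ((a x - A x) $ j) * (of_real (gauss_poly c p (x $ 3)) + \<i> * of_real (gauss_poly c q (x $ 3))) +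
      of_real (if j = 3 then 1 else 0) * (of_real (gauss_poly_deriv c p (x $ 3)) + \<i> * of_real (gauss_poly_deriv c q (x $ 3))))
      + of_real (A x $ j) * (of_real (gauss_poly c p (x $ 3)) + \<i> * of_real (gauss_poly c q (x $ 3)))) =
      exp (\<i> * of_real (potential_gap a A x)) *
     Complex (a x $ j * gauss_poly c p (x $ 3) + (if j = 3 then gauss_poly_deriv c q (x $ 3) else 0))
             (a x $ j * gauss_poly c q (x $ 3) - (if j = 3 then gauss_poly_deriv c p (x $ 3) else 0))"
    by (rule arg_cong[where f = "\<lambda>z. _ * z"]) (simp add: complex_eq_iff algebra_simps)
  then show ?thesis
    unfolding trial_gradient_def partial_trial by (simp add: trial_def algebra_simps)
qed

lemma norm_trial: "(norm (trial a A c p q x))\<^sup>2 = (gauss_poly c p (x $ 3))\<^sup>2 + (gauss_poly c q (x $ 3))\<^sup>2"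
proof -
  have "of_real (gauss_poly c p (x $ 3)) + \<i> * of_real (gauss_poly c q (x $ 3)) =
      Complex (gauss_poly c p (x $ 3)) (gauss_poly c q (x $ 3))"
    by (simp add: complex_eq_iff)
  then show ?thesis
    by (simp add: trial_def norm_mult complex_norm power2_eq_square del: of_real_mult)
qed

text \<open>The last term is 2 a_3 Im(conj f f') for f = P + i Q. It is zero for real f, but need
  not be pointwise for the complex combinations that orthogonality demands.\<close>

lemma norm_trial_gradient:
  "(norm (trial_gradient p q x))\<^sup>2 =
     (gauss_poly_deriv c p (x $ 3))\<^sup>2 + (gauss_poly_deriv c q (x $ 3))\<^sup>2
     + (norm (a x))\<^sup>2 * ((gauss_poly c p (x $ 3))\<^sup>2 + (gauss_poly c q (x $ 3))\<^sup>2)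
     + 2 * a x $ 3 * (gauss_poly c p (x $ 3) * gauss_poly_deriv c q (x $ 3)
                      - gauss_poly c q (x $ 3) * gauss_poly_deriv c p (x $ 3))"
proof -
  have "(norm (trial_gradient p q x))\<^sup>2 = (\<Sum>j\<in>UNIV. (norm (trial_gradient p q x $ j))\<^sup>2)"
    by (simp add: norm_vec_def L2_set_def sum_nonneg)
  moreover have "(norm (a x))\<^sup>2 = (\<Sum>j\<in>UNIV. (a x $ j)\<^sup>2)"
    by (simp add: norm_vec_def L2_set_def sum_nonneg)
  moreover have "(norm (trial_gradient p q x $ j))\<^sup>2 =
      (a x $ j * gauss_poly c p (x $ 3) + (if j = 3 then gauss_poly_deriv c q (x $ 3) else 0))\<^sup>2
      + (a x $ j * gauss_poly c q (x $ 3) - (if j = 3 then gauss_poly_deriv c p (x $ 3) else 0))\<^sup>2" for j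
    unfolding trial_gradient_nth norm_mult norm_exp_i_times complex_norm by simp
  moreover have "(a1 * P + 0)\<^sup>2 + (a1 * Q - 0)\<^sup>2 + ((a2 * P + 0)\<^sup>2 + (a2 * Q - 0)\<^sup>2) + ((a3 * P + Q')\<^sup>2 + (a3 * Q - P')\<^sup>2) =
      P'\<^sup>2 + Q'\<^sup>2 + (a1\<^sup>2 + a2\<^sup>2 + a3\<^sup>2) * (P\<^sup>2 + Q\<^sup>2) + 2 * a3 * (P * Q' - Q * P')"
    for a1 a2 a3 P Q P' Q' :: real
    by algebra
  moreover have "(1::3) \<noteq> 3" "(2::3) \<noteq> 3" by simp_all
  ultimately show ?thesis
    by (simp only: sum_3 if_False if_True refl)
qed

lemma continuous_trial:
  "continuous_on UNIV (trial a A c p q)" "continuous_on UNIV (partial j (trial a A c p q))"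
  "continuous_on UNIV (trial_gradient p q)"
proof -
  have x3: "continuous_on UNIV (\<lambda>x::real^3. x $ 3)"
    by (intro continuous_intros)
  note gp = continuous_on_gauss_poly[OF x3]
  have gap: "continuous_on UNIV (\<lambda>x. exp (\<i> * complex_of_real (potential_gap a A x)))"
    unfolding potential_gap_def by (intro continuous_intros) auto
  show 1: "continuous_on UNIV (trial a A c p q)"
    unfolding trial_def[abs_def] by (intro continuous_intros gap gp)
  show 2: "continuous_on UNIV (partial j (trial a A c p q))" for j
    unfolding partial_trial by (intro continuous_intros gap gp)
  show "continuous_on UNIV (trial_gradient p q)"
    unfolding trial_gradient_def[abs_def] by (intro continuous_on_vec_lambda continuous_intros 1 2)
qed

end

section \<open>Norms and energies of trial functions as Gaussian functionals\<close>

definition lift :: "real^2 \<Rightarrow> real^3" where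
  "lift y = vector [y $ 1, y $ 2, 1]"

lemma continuous_on_lift: "continuous_on UNIV lift"
  unfolding lift_def[abs_def] by (intro continuous_intros)

lemma cone_map_lift: "cone_map (t, y) = t *\<^sub>R lift y"
  by (simp add: cone_map_def lift_def vec_eq_iff forall_3)

lemma cone_map_nth_3: "cone_map (t, y) $ 3 = t"
  by (simp add: cone_map_def)

lemma integrable_indicator_continuous:
  fixes f :: "'a::euclidean_space \<Rightarrow> real"
  assumes "open S" "bounded S" "continuous_on UNIV f"
  shows "integrable lborel (\<lambda>x. indicator S x * f x)"
proof -
  obtain b where b: "S \<subseteq> cbox (- b) b"
    using bounded_subset_cbox_symmetric[OF assms(2)] by blast
  have "integrable lborel (\<lambda>x. indicator (cbox (- b) b) x *\<^sub>R f x)"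
    by (rule borel_integrable_compact) (auto intro: continuous_on_subset[OF assms(3)])
  then have "integrable lborel (\<lambda>x. indicator S x *\<^sub>R (indicator (cbox (- b) b) x *\<^sub>R f x))"
    by (rule integrable_mult_indicator[rotated]) (use assms(1) in auto)
  also have "(\<lambda>x. indicator S x *\<^sub>R (indicator (cbox (- b) b) x *\<^sub>R f x)) = (\<lambda>x. indicator S x * f x)"
    using b by (auto simp: fun_eq_iff indicator_def)
  finally show ?thesis .
qed

lemma gauss_weight_shift:
  "indicator {0<..} t * t\<^sup>2 * (exp (- c * t\<^sup>2) * poly r (t\<^sup>2)) = gauss_weight c ([:0,1:] * r) t"
  by (cases "t = 0") (auto simp: gauss_weight_def indicator_def)

text \<open>The factor \<open>[:0,1:]\<close> in front of \<open>r\<close> is the t^2 of the volume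
  element.\<close>

lemma cone_integral_gauss:
  fixes F :: "real^3 \<Rightarrow> real"
  assumes "open \<omega>" "bounded \<omega>" "c > 0" and F: "continuous_on UNIV F" and P: "continuous_on UNIV P"
    and eq: "\<And>t y. t > 0 \<Longrightarrow> y \<in> \<omega> \<Longrightarrow> F (cone_map (t, y)) = exp (- c * t\<^sup>2) * poly r (t\<^sup>2) * P y"
  shows "integrable (lebesgue_on (cone_over \<omega>)) F"
    "(LINT x|lebesgue_on (cone_over \<omega>). F x) = gauss_functional c ([:0,1:] * r) * (LINT y|lborel. indicator \<omega> y * P y)"
proof -
  have w: "(\<lambda>t. indicator {0<..} t * t\<^sup>2 * (exp (- c * t\<^sup>2) * poly r (t\<^sup>2))) = gauss_weight c ([:0,1:] * r)"
    by (rule ext) (rule gauss_weight_shift)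
  have g: "integrable lborel (\<lambda>t. indicator {0<..} t * t\<^sup>2 * (exp (- c * t\<^sup>2) * poly r (t\<^sup>2)))"
    unfolding w by (rule integrable_gauss_weight[OF assms(3)])
  note ci = cone_integral[OF assms(1) borel_measurable_continuous_onI[OF F], of "\<lambda>t. exp (- c * t\<^sup>2) * poly r (t\<^sup>2)" P,
      OF eq g integrable_indicator_continuous[OF assms(1,2) P]]
  show "integrable (lebesgue_on (cone_over \<omega>)) F"
    by (rule ci(1))
  show "(LINT x|lebesgue_on (cone_over \<omega>). F x) = gauss_functional c ([:0,1:] * r) * (LINT y|lborel. indicator \<omega> y * P y)"
    unfolding gauss_functional_def w[symmetric] by (rule ci(2))
qed

lemma measure_lborel_open_pos:
  fixes S :: "'a::euclidean_space set"
  assumes "open S" "bounded S" "S \<noteq> {}"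
  shows "measure lborel S > 0"
proof -
  obtain b where "S \<subseteq> cbox (- b) b"
    using bounded_subset_cbox_symmetric[OF assms(2)] by blast
  then have "emeasure lborel S \<le> emeasure lborel (cbox (- b) b)"
    by (rule emeasure_mono) auto
  then have "emeasure lborel S \<noteq> \<infinity>"
    by (auto simp: emeasure_lborel_cbox_eq top_unique split: if_split_asm)
  moreover have "emeasure lborel S \<noteq> 0"
    using assms(1,3) open_not_negligible[of S] by (auto simp: negligible_iff_null_sets null_sets_def)
  ultimately show ?thesis
    by (simp add: measure_def enn2real_positive_iff less_top zero_less_iff_neq_zero)
qed

context cone_trial
begin

lemma cone_lebesgue: "cone_over \<omega> \<in> sets lebesgue"
  using open_cone_over[OF \<omega>(1)] by (intro sets_completionI_sets) auto

lemma measurable_lebesgue_on_cone: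
  fixes f :: "real^3 \<Rightarrow> 'b::real_normed_vector"
  assumes "continuous_on UNIV f" shows "f \<in> borel_measurable (lebesgue_on (cone_over \<omega>))"
  by (intro measurable_restrict_space1 measurable_completion) (simp add: borel_measurable_continuous_onI[OF assms])

lemma trial_L2:
  "trial a A c p q \<in> L2 (cone_over \<omega>)"
  "L2_normsq (cone_over \<omega>) (trial a A c p q) = gauss_functional c ([:0,1:] * (p\<^sup>2 + q\<^sup>2)) * measure lborel \<omega>"
proof -
  have F: "continuous_on UNIV (\<lambda>x. (norm (trial a A c p q x))\<^sup>2)"
    by (intro continuous_intros continuous_trial(1))
  have eq: "(norm (trial a A c p q (cone_map (t, y))))\<^sup>2 = exp (- c * t\<^sup>2) * poly (p\<^sup>2 + q\<^sup>2) (t\<^sup>2) * 1" for t y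
    unfolding norm_trial cone_map_nth_3 power2_eq_square[of "gauss_poly _ _ _"] gauss_poly_mult
    by (simp add: power2_eq_square distrib_left)
  note ci = cone_integral_gauss[OF \<omega>(1,2) c F continuous_on_const eq]
  show "trial a A c p q \<in> L2 (cone_over \<omega>)"
    unfolding L2_def using ci(1) measurable_lebesgue_on_cone[OF continuous_trial(1)] by blast
  show "L2_normsq (cone_over \<omega>) (trial a A c p q) = gauss_functional c ([:0,1:] * (p\<^sup>2 + q\<^sup>2)) * measure lborel \<omega>"
    unfolding L2_normsq_def ci(2) using \<omega>(1) by simp
qed

lemma trial_normsq_pos:
  assumes "p \<noteq> 0 \<or> q \<noteq> 0"
  shows "L2_normsq (cone_over \<omega>) (trial a A c p q) > 0"
proof -
  have "p\<^sup>2 + q\<^sup>2 \<noteq> 0"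
  proof
    assume z: "p\<^sup>2 + q\<^sup>2 = 0"
    have "poly p s = 0 \<and> poly q s = 0" for s
      using arg_cong[OF z, of "\<lambda>r. poly r s"] by (simp add: sum_power2_eq_zero_iff)
    then have "p = 0" "q = 0"
      by (auto simp: poly_all_0_iff_0[symmetric])
    then show False using assms by simp
  qed
  then have "gauss_functional c ([:0,1:] * (p\<^sup>2 + q\<^sup>2)) > 0"
    by (intro gauss_functional_pos[OF c]) auto
  then show ?thesis
    unfolding trial_L2 using measure_lborel_open_pos[OF \<omega>] by simp
qed

lemma trial_not_AE_zero:
  assumes "p \<noteq> 0 \<or> q \<noteq> 0"
  shows "\<not> (AE x in lebesgue_on (cone_over \<omega>). trial a A c p q x = 0)"
proof
  assume ae: "AE x in lebesgue_on (cone_over \<omega>). trial a A c p q x = 0"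
  have "L2_normsq (cone_over \<omega>) (trial a A c p q) = 0"
    unfolding L2_normsq_def by (rule integral_eq_zero_AE) (use ae in auto)
  then show False using trial_normsq_pos[OF assms] by simp
qed

lemma a_cone_map: "a (cone_map (t, y)) = t *\<^sub>R a (lift y)"
  unfolding cone_map_lift by (rule linear_scale[OF a])

text \<open>Linearity gives a(t (y, 1)) = t a(y, 1), and the radial derivative also carries a factor
  t, so each of the three terms of the squared norm is t^2 times a polynomial in t^2, a Gaussian and
  a function of y. With the volume element this makes \<open>[:0,1:] ^ 2\<close>; the cross term
  integrates to zero by \<open>mean\<close>.\<close>

lemma trial_gradient_L2:
  fixes p q :: "real poly"
  assumes mean: "(LINT y|lborel. indicator \<omega> y * a (lift y) $ 3) = 0"
  defines "p' \<equiv> smult 2 (pderiv p) - smult c p" and "q' \<equiv> smult 2 (pderiv q) - smult c q"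
  shows "trial_gradient p q \<in> L2 (cone_over \<omega>)"
    "L2_normsq (cone_over \<omega>) (trial_gradient p q) =
      gauss_functional c ([:0,1:] ^ 2 * (p'\<^sup>2 + q'\<^sup>2)) * measure lborel \<omega> +
      gauss_functional c ([:0,1:] ^ 2 * (p\<^sup>2 + q\<^sup>2)) * (LINT y|lborel. indicator \<omega> y * (norm (a (lift y)))\<^sup>2)"
proof -
  have x3: "continuous_on UNIV (\<lambda>x::real^3. x $ 3)"
    by (intro continuous_intros)
  note gp = continuous_on_gauss_poly[OF x3]
  let ?F1 = "\<lambda>x::real^3. (gauss_poly_deriv c p (x $ 3))\<^sup>2 + (gauss_poly_deriv c q (x $ 3))\<^sup>2"
  let ?F2 = "\<lambda>x. (norm (a x))\<^sup>2 * ((gauss_poly c p (x $ 3))\<^sup>2 + (gauss_poly c q (x $ 3))\<^sup>2)"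
  let ?F3 = "\<lambda>x. 2 * a x $ 3 * (gauss_poly c p (x $ 3) * gauss_poly_deriv c q (x $ 3)
                      - gauss_poly c q (x $ 3) * gauss_poly_deriv c p (x $ 3))"
  have c1: "continuous_on UNIV ?F1" and c2: "continuous_on UNIV ?F2" and c3: "continuous_on UNIV ?F3"
    by (intro continuous_intros gp)+
  have al: "continuous_on UNIV (\<lambda>y. a (lift y))"
    by (intro continuous_intros continuous_on_lift)
  have p2: "continuous_on UNIV (\<lambda>y. (norm (a (lift y)))\<^sup>2)" and p3: "continuous_on UNIV (\<lambda>y. a (lift y) $ 3)"
    by (intro continuous_intros al)+
  have e1: "?F1 (cone_map (t, y)) = exp (- c * t\<^sup>2) * poly ([:0,1:] * (p'\<^sup>2 + q'\<^sup>2)) (t\<^sup>2) * 1" for t y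
  proof -
    have "?F1 (cone_map (t, y)) = t\<^sup>2 * (gauss_poly c p' t * gauss_poly c p' t + gauss_poly c q' t * gauss_poly c q' t)"
      unfolding cone_map_nth_3 gauss_poly_deriv_def p'_def q'_def by algebra
    then show ?thesis
      unfolding gauss_poly_mult by (simp add: power2_eq_square algebra_simps)
  qed
  have e2: "?F2 (cone_map (t, y)) = exp (- c * t\<^sup>2) * poly ([:0,1:] * (p\<^sup>2 + q\<^sup>2)) (t\<^sup>2) * (norm (a (lift y)))\<^sup>2" for t y
  proof -
    have "?F2 (cone_map (t, y)) = t\<^sup>2 * (norm (a (lift y)))\<^sup>2 * (gauss_poly c p t * gauss_poly c p t + gauss_poly c q t * gauss_poly c q t)"
      unfolding cone_map_nth_3 a_cone_map norm_scaleR by (simp add: power_mult_distrib power2_eq_square[of "gauss_poly _ _ _"])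
    then show ?thesis
      unfolding gauss_poly_mult by (simp add: power2_eq_square algebra_simps)
  qed
  have e3: "?F3 (cone_map (t, y)) = exp (- c * t\<^sup>2) * poly ([:0,1:] * smult 2 (p * q' - q * p')) (t\<^sup>2) * a (lift y) $ 3" for t y
  proof -
    have "?F3 (cone_map (t, y)) = 2 * t\<^sup>2 * a (lift y) $ 3 * (gauss_poly c p t * gauss_poly c q' t - gauss_poly c q t * gauss_poly c p' t)"
      unfolding cone_map_nth_3 a_cone_map gauss_poly_deriv_def p'_def q'_def vector_scaleR_component real_scaleR_def by algebra
    then show ?thesis
      unfolding gauss_poly_mult by (simp add: power2_eq_square algebra_simps)
  qed
  note i1 = cone_integral_gauss[OF \<omega>(1,2) c c1 continuous_on_const e1]
  note i2 = cone_integral_gauss[OF \<omega>(1,2) c c2 p2 e2]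
  note i3 = cone_integral_gauss[OF \<omega>(1,2) c c3 p3 e3]
  have "integrable (lebesgue_on (cone_over \<omega>)) (\<lambda>x. (norm (trial_gradient p q x))\<^sup>2)"
    unfolding norm_trial_gradient by (intro Bochner_Integration.integrable_add i1 i2 i3)
  then show "trial_gradient p q \<in> L2 (cone_over \<omega>)"
    unfolding L2_def using measurable_lebesgue_on_cone[OF continuous_trial(3)] by blast
  have "L2_normsq (cone_over \<omega>) (trial_gradient p q) =
      (LINT x|lebesgue_on (cone_over \<omega>). ?F1 x) + (LINT x|lebesgue_on (cone_over \<omega>). ?F2 x) + (LINT x|lebesgue_on (cone_over \<omega>). ?F3 x)"
    unfolding L2_normsq_def norm_trial_gradient
    by (simp only: Bochner_Integration.integral_add Bochner_Integration.integrable_add i1(1) i2(1) i3(1))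
  then show "L2_normsq (cone_over \<omega>) (trial_gradient p q) =
      gauss_functional c ([:0,1:] ^ 2 * (p'\<^sup>2 + q'\<^sup>2)) * measure lborel \<omega> +
      gauss_functional c ([:0,1:] ^ 2 * (p\<^sup>2 + q\<^sup>2)) * (LINT y|lborel. indicator \<omega> y * (norm (a (lift y)))\<^sup>2)"
    unfolding i1(2) i2(2) i3(2) mean power2_eq_square[of "[:0,1:]"] mult.assoc[of "[:0,1:]" "[:0,1:]"]
    using \<omega>(1) by simp
qed

lemma trial_is_magnetic_gradient:
  "is_magnetic_gradient A (cone_over \<omega>) (trial a A c p q) (trial_gradient p q)"
  unfolding trial_gradient_def[abs_def]
proof (rule is_magnetic_gradient_C1[OF cone_lebesgue])
  show "continuous_on UNIV A"
    by (rule linear_continuous_on) (use A in \<open>simp add: linear_conv_bounded_linear\<close>)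
  show "trial a A c p q differentiable at x" for x
    using trial_has_derivative by (rule differentiableI)
qed (rule continuous_trial)

text \<open>After the cross term is gone, the energy is a sum of separate contributions of p and q,
  and the oscillator bound applies to each. The hypothesis \<open>energy\<close> may be inserted
  because its coefficient is a nonnegative functional.\<close>

lemma trial_form_bound:
  assumes mean: "(LINT y|lborel. indicator \<omega> y * a (lift y) $ 3) = 0"
    and energy: "(LINT y|lborel. indicator \<omega> y * (norm (a (lift y)))\<^sup>2) \<le> c\<^sup>2 * measure lborel \<omega>"
    and deg: "degree p \<le> m" "degree q \<le> m"
  shows "trial a A c p q \<in> Dom_q A (cone_over \<omega>)"
    "magnetic_form A (cone_over \<omega>) (trial a A c p q) \<le> (4 * real m + 3) * c * L2_normsq (cone_over \<omega>) (trial a A c p q)"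
proof -
  note g = trial_gradient_L2[OF mean, of p q]
  show "trial a A c p q \<in> Dom_q A (cone_over \<omega>)"
    unfolding Dom_q_def using trial_L2(1) g(1) trial_is_magnetic_gradient by blast
  define V where "V = measure lborel \<omega>"
  define X :: "real poly" where "X = [:0,1:]"
  define G where "G = gauss_functional c"
  define p' where "p' = smult 2 (pderiv p) - smult c p"
  define q' where "q' = smult 2 (pderiv q) - smult c q"
  note lin = gauss_functional_add[OF c, folded G_def] gauss_functional_smult[of c, folded G_def]
  have V: "V > 0" unfolding V_def by (rule measure_lborel_open_pos[OF \<omega>])
  have N: "L2_normsq (cone_over \<omega>) (trial a A c p q) = (G (X * p\<^sup>2) + G (X * q\<^sup>2)) * V"
    unfolding trial_L2 G_def[symmetric] X_def[symmetric] V_def[symmetric] distrib_left lin ..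
  have nonneg: "G (X ^ 2 * (p\<^sup>2 + q\<^sup>2)) \<ge> 0"
    unfolding G_def X_def by (rule gauss_functional_nonneg) simp
  have b: "G (X ^ 2 * r'\<^sup>2) + c\<^sup>2 * G (X ^ 2 * r\<^sup>2) \<le> (4 * real m + 3) * c * G (X * r\<^sup>2)"
    if "degree r \<le> m" "r' = smult 2 (pderiv r) - smult c r" for r r'
    using gauss_functional_oscillator_bound[OF c that(1), folded G_def X_def that(2)]
    unfolding distrib_left mult_smult_right lin .
  have "magnetic_form A (cone_over \<omega>) (trial a A c p q) = L2_normsq (cone_over \<omega>) (trial_gradient p q)"
    by (rule magnetic_form_eq[OF open_cone_over[OF \<omega>(1)] g(1) trial_is_magnetic_gradient])
  also have "\<dots> = G (X ^ 2 * (p'\<^sup>2 + q'\<^sup>2)) * V + G (X ^ 2 * (p\<^sup>2 + q\<^sup>2)) * (LINT y|lborel. indicator \<omega> y * (norm (a (lift y)))\<^sup>2)"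
    unfolding g(2) G_def X_def V_def p'_def q'_def ..
  also have "\<dots> \<le> G (X ^ 2 * (p'\<^sup>2 + q'\<^sup>2)) * V + G (X ^ 2 * (p\<^sup>2 + q\<^sup>2)) * (c\<^sup>2 * V)"
    using mult_left_mono[OF energy nonneg] by (simp add: V_def)
  also have "\<dots> = ((G (X ^ 2 * p'\<^sup>2) + c\<^sup>2 * G (X ^ 2 * p\<^sup>2)) + (G (X ^ 2 * q'\<^sup>2) + c\<^sup>2 * G (X ^ 2 * q\<^sup>2))) * V"
    unfolding distrib_left lin by algebra
  also have "\<dots> \<le> ((4 * real m + 3) * c * G (X * p\<^sup>2) + (4 * real m + 3) * c * G (X * q\<^sup>2)) * V"
    by (intro mult_right_mono add_mono b deg p'_def q'_def less_imp_le[OF V])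
  also have "\<dots> = (4 * real m + 3) * c * ((G (X * p\<^sup>2) + G (X * q\<^sup>2)) * V)"
    by algebra
  finally show "magnetic_form A (cone_over \<omega>) (trial a A c p q) \<le> (4 * real m + 3) * c * L2_normsq (cone_over \<omega>) (trial a A c p q)"
    unfolding N .
qed

end

section \<open>The Rayleigh quotient\<close>

text \<open>Gaussian elimination: if equation i has a nonzero coefficient at some unknown r, that
  unknown is eliminated from the other equations, leaving one equation and one unknown
  fewer.\<close>

lemma underdetermined_system:
  fixes M :: "'k \<Rightarrow> 'i \<Rightarrow> 'a::field"
  assumes "finite I" "finite K" "card I < card K"
  shows "\<exists>x. (\<exists>k\<in>K. x k \<noteq> 0) \<and> (\<forall>i\<in>I. (\<Sum>k\<in>K. x k * M k i) = 0)"
  using assms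
proof (induction I arbitrary: K M rule: finite_induct)
  case empty
  then show ?case
    by (intro exI[of _ "\<lambda>_. 1"]) (auto simp: card_gt_0_iff)
next
  case (insert i I)
  show ?case
  proof (cases "\<forall>k\<in>K. M k i = 0")
    case True
    then show ?thesis
      using insert.IH[of K M] insert.prems insert.hyps by auto
  next
    case False
    then obtain r where r: "r \<in> K" "M r i \<noteq> 0" by auto
    define K' where "K' = K - {r}"
    have K: "K = insert r K'" "r \<notin> K'" "finite K'"
      using r insert.prems by (auto simp: K'_def)
    have "card I < card K'"
      using insert.prems insert.hyps r by (simp add: K'_def)
    then obtain x where x: "\<exists>k\<in>K'. x k \<noteq> 0"
        "\<And>j. j \<in> I \<Longrightarrow> (\<Sum>k\<in>K'. x k * (M k j - M k i / M r i * M r j)) = 0"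
      using insert.IH[OF K(3), of "\<lambda>k j. M k j - M k i / M r i * M r j"] by blast
    \<comment> \<open>The value of the unknown r that solves equation i once the others are
      known.\<close>
    define s where "s = - (\<Sum>k\<in>K'. x k * M k i) / M r i"
    define y where "y = x(r := s)"
    have sum: "(\<Sum>k\<in>K. y k * M k j) = s * M r j + (\<Sum>k\<in>K'. x k * M k j)" for j
    proof -
      have "(\<Sum>k\<in>K'. y k * M k j) = (\<Sum>k\<in>K'. x k * M k j)"
        using K(2) by (intro sum.cong) (auto simp: y_def)
      then show ?thesis
        using K by (simp add: y_def)
    qed
    have "(\<Sum>k\<in>K. y k * M k i) = 0"
      unfolding sum s_def using r(2) by simp
    moreover have "(\<Sum>k\<in>K. y k * M k j) = 0" if "j \<in> I" for j
    proof -
      have "0 = (\<Sum>k\<in>K'. x k * M k j) - (\<Sum>k\<in>K'. x k * M k i) / M r i * M r j"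
        using x(2)[OF that]
        by (simp add: right_diff_distrib sum_subtractf sum_divide_distrib sum_distrib_right mult.assoc)
      then show ?thesis
        unfolding sum s_def by (simp add: algebra_simps)
    qed
    moreover have "\<exists>k\<in>K. y k \<noteq> 0"
      using x(1) K by (auto simp: y_def)
    ultimately show ?thesis by auto
  qed
qed

lemma L2_inner_sum:
  fixes f :: "'k \<Rightarrow> 'a::euclidean_space \<Rightarrow> complex"
  assumes "finite K" "\<And>k. k \<in> K \<Longrightarrow> f k \<in> L2 \<Omega>" "w \<in> L2 \<Omega>"
  shows "L2_inner \<Omega> (\<lambda>x. \<Sum>k\<in>K. c k * f k x) w = (\<Sum>k\<in>K. c k * L2_inner \<Omega> (f k) w)"
proof -
  have i: "integrable (lebesgue_on \<Omega>) (\<lambda>x. f k x * cnj (w x))" if "k \<in> K" for k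
    by (rule L2_mult_integrable[OF assms(2)[OF that] L2_cnj[OF assms(3)]])
  have "(\<lambda>x. (\<Sum>k\<in>K. c k * f k x) * cnj (w x)) = (\<lambda>x. \<Sum>k\<in>K. c k * (f k x * cnj (w x)))"
    by (simp add: sum_distrib_right mult.assoc)
  then show ?thesis
    unfolding L2_inner_def using i by simp
qed

context cone_trial
begin

text \<open>Trial functions are complex linear in p + i q, so complex coefficients z can be
  distributed to p and q as real and imaginary parts. The orthogonality conditions thereby become a
  linear system for z.\<close>

lemma trial_sum:
  assumes "finite K"
  shows "trial a A c (\<Sum>k\<in>K. monom (Re (z k)) k) (\<Sum>k\<in>K. monom (Im (z k)) k) =
    (\<lambda>x. \<Sum>k\<in>K. z k * trial a A c (monom 1 k) 0 x)"
proof
  fix x :: "real^3"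
  define E where "E = exp (- c * (x $ 3)\<^sup>2 / 2)"
  have 1: "of_real (gauss_poly c (\<Sum>k\<in>K. monom (Re (z k)) k) (x $ 3)) + \<i> * of_real (gauss_poly c (\<Sum>k\<in>K. monom (Im (z k)) k) (x $ 3))
     = (\<Sum>k\<in>K. z k * of_real (gauss_poly c (monom 1 k) (x $ 3)))"
    by (simp add: complex_eq_iff gauss_poly_def poly_sum poly_monom sum_distrib_left mult_ac)
  have 2: "trial a A c (monom 1 k) 0 x = exp (\<i> * of_real (potential_gap a A x)) * of_real (gauss_poly c (monom 1 k) (x $ 3))" for k
    by (simp add: trial_def gauss_poly_def)
  show "trial a A c (\<Sum>k\<in>K. monom (Re (z k)) k) (\<Sum>k\<in>K. monom (Im (z k)) k) x =
    (\<Sum>k\<in>K. z k * trial a A c (monom 1 k) 0 x)"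
    unfolding 2 by (subst trial_def, subst 1) (simp add: sum_distrib_left mult.left_commute)
qed

text \<open>The n trial functions built from the monomials of degree 0 to n - 1 meet only n - 1
  orthogonality conditions, so some nonzero combination is admissible in the infimum.\<close>

lemma rayleigh_quotient_le:
  assumes mean: "(LINT y|lborel. indicator \<omega> y * a (lift y) $ 3) = 0"
    and energy: "(LINT y|lborel. indicator \<omega> y * (norm (a (lift y)))\<^sup>2) \<le> c\<^sup>2 * measure lborel \<omega>"
    and n: "n \<ge> 1"
  shows "rayleigh_quotient n A (cone_over \<omega>) \<le> ereal ((4 * real n - 1) * c)"
  unfolding rayleigh_quotient_def
proof (rule SUP_least)
  fix us :: "nat \<Rightarrow> real^3 \<Rightarrow> complex"
  assume "us \<in> {us. \<forall>i\<in>{1..<n}. us i \<in> Dom_q A (cone_over \<omega>)}"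
  then have us: "us i \<in> L2 (cone_over \<omega>)" if "i \<in> {1..<n}" for i
    using that by (auto simp: Dom_q_def)
  have "card {1..<n} < card {..<n}"
    using n by simp
  from underdetermined_system[OF _ _ this, of "\<lambda>k i. L2_inner (cone_over \<omega>) (trial a A c (monom 1 k) 0) (us i)"]
  obtain z where z: "\<exists>k\<in>{..<n}. z k \<noteq> 0"
    "\<And>i. i \<in> {1..<n} \<Longrightarrow> (\<Sum>k<n. z k * L2_inner (cone_over \<omega>) (trial a A c (monom 1 k) 0) (us i)) = 0"
    by (meson finite_atLeastLessThan finite_lessThan)
  define p where "p = (\<Sum>k<n. monom (Re (z k)) k)"
  define q where "q = (\<Sum>k<n. monom (Im (z k)) k)"
  define u where "u = trial a A c p q"
  have deg: "degree p \<le> n - 1" "degree q \<le> n - 1"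
    unfolding p_def q_def by (auto intro!: degree_sum_le order_trans[OF degree_monom_le])
  have nz: "p \<noteq> 0 \<or> q \<noteq> 0"
  proof -
    obtain k where k: "k < n" "z k \<noteq> 0" using z(1) by auto
    then have "coeff p k = Re (z k)" "coeff q k = Im (z k)"
      by (simp_all add: p_def q_def coeff_sum)
    then show ?thesis
      using k by (auto simp: complex_eq_iff)
  qed
  note b = trial_form_bound[OF mean energy deg, folded u_def]
  have orth: "L2_inner (cone_over \<omega>) u (us i) = 0" if "i \<in> {1..<n}" for i
    unfolding u_def p_def q_def trial_sum[OF finite_lessThan]
    by (subst L2_inner_sum) (use us[OF that] z(2)[OF that] trial_L2 in auto)
  \<comment> \<open>The degrees reach n - 1, so the oscillator constant 4 m + 3 is used with m = n -
    1.\<close>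
  have "4 * real (n - 1) + 3 = 4 * real n - 1"
    using n by (simp add: of_nat_diff)
  with b(2) have "magnetic_form A (cone_over \<omega>) u / L2_normsq (cone_over \<omega>) u \<le> (4 * real n - 1) * c"
    using trial_normsq_pos[OF nz, folded u_def] by (simp add: divide_le_eq)
  moreover have "u \<in> {u \<in> Dom_q A (cone_over \<omega>). \<not> (AE x in lebesgue_on (cone_over \<omega>). u x = 0) \<and>
      (\<forall>i\<in>{1..<n}. L2_inner (cone_over \<omega>) u (us i) = 0)}"
    using b(1) orth trial_not_AE_zero[OF nz, folded u_def] by blast
  ultimately show "(INF u \<in> {u \<in> Dom_q A (cone_over \<omega>). \<not> (AE x in lebesgue_on (cone_over \<omega>). u x = 0) \<and>
      (\<forall>i\<in>{1..<n}. L2_inner (cone_over \<omega>) u (us i) = 0)}.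
        ereal (magnetic_form A (cone_over \<omega>) u / L2_normsq (cone_over \<omega>) u)) \<le> ereal ((4 * real n - 1) * c)"
    by (intro INF_lower2[of u]) auto
qed

end

section \<open>Functions vanishing on open sets\<close>

lemma continuous_integral_eq_0:
  fixes f :: "'a::euclidean_space \<Rightarrow> real"
  assumes S: "open S" "bounded S" and f: "continuous_on UNIV f" "\<And>x. f x \<ge> 0"
    and z: "(LINT x|lborel. indicator S x * f x) = 0" and x: "x \<in> S"
  shows "f x = 0"
proof (rule ccontr)
  assume "f x \<noteq> 0"
  define U where "U = S \<inter> f -` (- {0})"
  have "open U"
    unfolding U_def by (intro open_Int S open_vimage f) auto
  have "AE x in lborel. indicator S x * f x = 0"
    using integral_nonneg_eq_0_iff_AE[OF integrable_indicator_continuous[OF S f(1)]] f(2) z by simp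
  then have "AE x in lborel. x \<notin> U"
    by eventually_elim (auto simp: U_def split: split_indicator_asm)
  then have "U \<in> null_sets lborel"
    using \<open>open U\<close> by (subst (asm) AE_iff_null_sets[symmetric]) auto
  then have "negligible U"
    by (simp add: negligible_iff_null_sets null_sets_completionI)
  then show False
    using open_not_negligible[OF \<open>open U\<close>] \<open>f x \<noteq> 0\<close> x by (auto simp: U_def)
qed

lemma linear_form_zero_on_open:
  fixes S :: "(real^2) set"
  assumes "open S" "S \<noteq> {}" and z: "\<And>y. y \<in> S \<Longrightarrow> \<alpha> * y $ 1 + \<beta> * y $ 2 = 0"
  shows "\<alpha> = 0" "\<beta> = 0"
proof -
  obtain y where y: "y \<in> S" using assms(2) by auto
  obtain e where e: "e > 0" "ball y e \<subseteq> S"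
    using assms(1) y by (auto simp: open_contains_ball)
  have "y + (e / 2) *\<^sub>R axis i 1 \<in> S" for i
    using e by (intro subsetD[OF e(2)]) (simp add: dist_norm)
  from z[OF this[of 1]] z[OF this[of 2]]
  have "\<alpha> * (e / 2) + (\<alpha> * y $ 1 + \<beta> * y $ 2) = 0" "\<beta> * (e / 2) + (\<alpha> * y $ 1 + \<beta> * y $ 2) = 0"
    by (simp_all add: axis_def algebra_simps)
  then have "\<alpha> * (e / 2) = 0" "\<beta> * (e / 2) = 0"
    unfolding z[OF y] by simp_all
  then show "\<alpha> = 0" "\<beta> = 0" using e(1) by auto
qed

section \<open>The optimal linear potential\<close>

lemma linear_expand_3:
  fixes f :: "real^3 \<Rightarrow> real^3"
  assumes "linear f"
  shows "f x $ k = x $ 1 * f (axis 1 1) $ k + x $ 2 * f (axis 2 1) $ k + x $ 3 * f (axis 3 1) $ k"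
proof -
  have "x = x $ 1 *\<^sub>R axis 1 1 + x $ 2 *\<^sub>R axis 2 1 + x $ 3 *\<^sub>R axis 3 1"
    by (simp add: vec_eq_iff forall_3 axis_def)
  then have "f x = x $ 1 *\<^sub>R f (axis 1 1) + x $ 2 *\<^sub>R f (axis 2 1) + x $ 3 *\<^sub>R f (axis 3 1)"
    by (metis linear_add[OF assms] linear_scale[OF assms])
  then show ?thesis by simp
qed

lemma curl_linear:
  assumes A: "linear A"
  shows "curl A x = vector
    [A (axis 2 1) $ 3 - A (axis 3 1) $ 2, A (axis 3 1) $ 1 - A (axis 1 1) $ 3, A (axis 1 1) $ 2 - A (axis 2 1) $ 1]"
proof -
  have "partial i (\<lambda>y. A y $ k) x = A (axis i 1) $ k" for i k
  proof (rule partial_eq)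
    have "bounded_linear A"
      using A by (simp add: linear_conv_bounded_linear)
    then show "((\<lambda>y. A y $ k) has_derivative (\<lambda>y. A y $ k)) (at x)"
      by (intro bounded_linear_imp_has_derivative bounded_linear_compose[OF bounded_linear_vec_nth])
  qed
  then show ?thesis by (simp add: curl_def)
qed

text \<open>The first two components minimise the mean of $|a(y, 1)|^2$ over \<open>\<omega>\<close> among the linear potentials
  of the field $(0, 0, B_3)$. The gauge term $d x_3$ makes the mean of $a_3(y, 1)$ vanish; this removes a cross
  term from the energy of the trial functions with complex coefficients.\<close>

definition optimal_potential :: "real \<Rightarrow> real \<Rightarrow> real \<Rightarrow> real^3 \<Rightarrow> real \<Rightarrow> real^3 \<Rightarrow> real^3" where
  "optimal_potential m0 m1 m2 B d x = vector
     [B $ 3 / (m0 + m2) * (m1 * x $ 1 - m2 * x $ 2), B $ 3 / (m0 + m2) * (m0 * x $ 1 - m1 * x $ 2),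
      B $ 1 * x $ 2 - B $ 2 * x $ 1 - d * x $ 3]"

lemma linear_optimal_potential: "linear (optimal_potential m0 m1 m2 B d)"
  by (rule linearI) (auto simp: optimal_potential_def vec_eq_iff forall_3 algebra_simps)

text \<open>Both potentials have curl \<open>B\<close>: the coefficients m0 and m2 add up to give
  B_3, and the term with \<open>d\<close> sits on the diagonal and leaves the curl unchanged.
  Writing B_3 as \<kappa> (m0 + m2) removes the division and leaves a polynomial consequence of the
  three curl equations.\<close>

lemma optimal_potential_symmetric:
  fixes m0 m1 m2 d :: real
  assumes A: "linear A" "\<And>x. curl A x = B" and s: "m0 + m2 \<noteq> 0"
  defines "a \<equiv> optimal_potential m0 m1 m2 B d"
  shows "h \<bullet> (a x - A x) = x \<bullet> (a h - A h)"
proof -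
  define \<kappa> where "\<kappa> = B $ 3 / (m0 + m2)"
  have k: "B $ 3 = \<kappa> * (m0 + m2)"
    using s by (simp add: \<kappa>_def)
  have B: "B $ 1 = A (axis 2 1) $ 3 - A (axis 3 1) $ 2" "B $ 2 = A (axis 3 1) $ 1 - A (axis 1 1) $ 3"
    "\<kappa> * (m0 + m2) = A (axis 1 1) $ 2 - A (axis 2 1) $ 1"
    unfolding A(2)[of 0, symmetric] curl_linear[OF A(1)] k[symmetric] by simp_all
  have av: "a x $ 1 = \<kappa> * (m1 * x $ 1 - m2 * x $ 2)" "a x $ 2 = \<kappa> * (m0 * x $ 1 - m1 * x $ 2)"
      "a x $ 3 = B $ 1 * x $ 2 - B $ 2 * x $ 1 - d * x $ 3" for x
    by (simp_all add: a_def optimal_potential_def \<kappa>_def)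
  show ?thesis
    unfolding inner_vec_def sum_3 inner_real_def vector_minus_component av
      linear_expand_3[OF A(1), of x] linear_expand_3[OF A(1), of h]
    using B by algebra
qed

section \<open>Moments of the base and the energy of the optimal potential\<close>

context
  fixes \<omega> :: "(real^2) set"
  assumes \<omega>: "\<omega> \<noteq> {}" "open \<omega>" "bounded \<omega>"
begin

definition base_integral :: "(real^2 \<Rightarrow> real) \<Rightarrow> real" where
  "base_integral f = (LINT y|lborel. indicator \<omega> y * f y)"

lemma base_integral_add:
  "continuous_on UNIV f \<Longrightarrow> continuous_on UNIV g \<Longrightarrow> base_integral (\<lambda>y. f y + g y) = base_integral f + base_integral g"
  unfolding base_integral_def distrib_left
  by (intro Bochner_Integration.integral_add integrable_indicator_continuous \<omega>)

lemma base_integral_cmult: "base_integral (\<lambda>y. k * f y) = k * base_integral f"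
  unfolding base_integral_def mult.left_commute[of _ k] by simp

lemma base_integral_const: "base_integral (\<lambda>y. k) = k * measure lborel \<omega>"
  using \<omega>(2) by (simp add: base_integral_def)

lemma base_integral_moment:
  "base_integral (\<lambda>y. (y $ 1) ^ k * (y $ 2) ^ (2 - k)) = moment \<omega> k * measure lborel \<omega>"
proof -
  have "continuous_on UNIV (\<lambda>y::real^2. (y $ 1) ^ k * (y $ 2) ^ (2 - k))"
    by (intro continuous_intros)
  then have "(LINT y|lebesgue_on \<omega>. (y $ 1) ^ k * (y $ 2) ^ (2 - k)) = base_integral (\<lambda>y. (y $ 1) ^ k * (y $ 2) ^ (2 - k))"
    unfolding base_integral_def using \<omega>(2)
    by (simp add: integral_restrict_space integral_completion borel_measurable_continuous_onI sets_completionI_sets)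
  then show ?thesis
    using measure_lborel_open_pos[OF \<omega>(2,3,1)] \<omega>(2) by (simp add: moment_def measure_completion)
qed

lemma base_integral_quadratic:
  "base_integral (\<lambda>y. \<alpha> * (y $ 1)\<^sup>2 + \<beta> * (y $ 1 * y $ 2) + \<gamma> * (y $ 2)\<^sup>2) =
    (\<alpha> * moment \<omega> 2 + \<beta> * moment \<omega> 1 + \<gamma> * moment \<omega> 0) * measure lborel \<omega>"
proof -
  have m: "base_integral (\<lambda>y. (y $ 1)\<^sup>2) = moment \<omega> 2 * measure lborel \<omega>"
    "base_integral (\<lambda>y. y $ 1 * y $ 2) = moment \<omega> 1 * measure lborel \<omega>"
    "base_integral (\<lambda>y. (y $ 2)\<^sup>2) = moment \<omega> 0 * measure lborel \<omega>"
    using base_integral_moment[of 2] base_integral_moment[of 1] base_integral_moment[of 0] by simp_all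
  have c: "continuous_on UNIV (\<lambda>y::real^2. \<alpha> * (y $ 1)\<^sup>2)" "continuous_on UNIV (\<lambda>y::real^2. \<beta> * (y $ 1 * y $ 2))"
    "continuous_on UNIV (\<lambda>y::real^2. \<gamma> * (y $ 2)\<^sup>2)"
    by (intro continuous_intros)+
  show ?thesis
    by (simp only: base_integral_add[OF continuous_on_add[OF c(1,2)] c(3)] base_integral_add[OF c(1,2)]
        base_integral_cmult m) algebra
qed

text \<open>These are the means of y_2^2 and y_1^2 respectively, and neither coordinate can vanish
  on a nonempty open set. The indices are crossed: moment 0 belongs to the second
  coordinate.\<close>

lemma moment_pos: "moment \<omega> 0 > 0" "moment \<omega> 2 > 0"
proof -
  note V = measure_lborel_open_pos[OF \<omega>(2,3,1)]
  have nz: "moment \<omega> i \<noteq> 0" and nn: "moment \<omega> i \<ge> 0"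
    if f: "base_integral (\<lambda>y. (y $ j)\<^sup>2) = moment \<omega> i * measure lborel \<omega>"
      and lin: "\<not> (\<forall>y\<in>\<omega>. y $ j = 0)" for i j
  proof -
    have c: "continuous_on UNIV (\<lambda>y::real^2. (y $ j)\<^sup>2)"
      by (intro continuous_intros)
    show "moment \<omega> i \<noteq> 0"
    proof
      assume "moment \<omega> i = 0"
      then have "(LINT y|lborel. indicator \<omega> y * (y $ j)\<^sup>2) = 0"
        using f by (simp add: base_integral_def)
      then have "(y $ j)\<^sup>2 = 0" if "y \<in> \<omega>" for y
        using continuous_integral_eq_0[OF \<omega>(2,3) c _ _ that] by simp
      then show False using lin by simp
    qed
    have "base_integral (\<lambda>y. (y $ j)\<^sup>2) \<ge> 0"
      unfolding base_integral_def by (rule integral_nonneg_AE) simp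
    then show "moment \<omega> i \<ge> 0"
      using V f by (simp add: zero_le_mult_iff)
  qed
  have "\<not> (\<forall>y\<in>\<omega>. y $ 2 = 0)" "\<not> (\<forall>y\<in>\<omega>. y $ 1 = 0)"
    using linear_form_zero_on_open(2)[OF \<omega>(2,1), of 0 1] linear_form_zero_on_open(1)[OF \<omega>(2,1), of 1 0] by auto
  then show "moment \<omega> 0 > 0" "moment \<omega> 2 > 0"
    using nz[of 2 0] nn[of 2 0] nz[of 1 2] nn[of 1 2] base_integral_moment[of 2] base_integral_moment[of 0]
    by (simp_all add: less_le)
qed

definition e_radicand :: "real^3 \<Rightarrow> real" where
  "e_radicand B = (B $ 3)\<^sup>2 * ((moment \<omega> 0 * moment \<omega> 2 - (moment \<omega> 1)\<^sup>2) / (moment \<omega> 0 + moment \<omega> 2))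
     + (B $ 2)\<^sup>2 * moment \<omega> 2 + (B $ 1)\<^sup>2 * moment \<omega> 0 - 2 * (B $ 1) * (B $ 2) * moment \<omega> 1"

lemma e_const_eq: "e_const B \<omega> = sqrt (e_radicand B)"
  by (simp add: e_const_def e_radicand_def Let_def)

abbreviation potential :: "real^3 \<Rightarrow> real \<Rightarrow> real^3 \<Rightarrow> real^3" where
  "potential B \<equiv> optimal_potential (moment \<omega> 0) (moment \<omega> 1) (moment \<omega> 2) B"

lemma potential_lift_nth_3: "potential B d (lift y) $ 3 = B $ 1 * y $ 2 - B $ 2 * y $ 1 - d"
  by (simp add: optimal_potential_def lift_def)

lemma continuous_potential_lift: "continuous_on UNIV (\<lambda>y. potential B d (lift y))"
  by (rule linear_continuous_on_compose[OF continuous_on_lift linear_optimal_potential])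

text \<open>The hypothesis makes d the mean of w = B_1 y_2 - B_2 y_1. The first two components
  contribute \<kappa>^2 (m0 + m2) (m0 m2 - m1^2), the B_3 term of the radicand; the third
  contributes the mean of (w - d)^2, which is the mean of w^2 minus d^2.\<close>

lemma potential_energy:
  assumes d: "d * measure lborel \<omega> = base_integral (\<lambda>y. B $ 1 * y $ 2 - B $ 2 * y $ 1)"
  shows "base_integral (\<lambda>y. potential B d (lift y) $ 3) = 0"
    "base_integral (\<lambda>y. (norm (potential B 0 (lift y)))\<^sup>2) = e_radicand B * measure lborel \<omega>"
    "base_integral (\<lambda>y. (norm (potential B d (lift y)))\<^sup>2) = (e_radicand B - d\<^sup>2) * measure lborel \<omega>"
proof -
  let ?V = "measure lborel \<omega>"
  define m0 m1 m2 where m: "m0 = moment \<omega> 0" "m1 = moment \<omega> 1" "m2 = moment \<omega> 2"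
  have s: "m0 + m2 > 0"
    using moment_pos by (simp add: m)
  define \<kappa> where "\<kappa> = B $ 3 / (m0 + m2)"
  have k: "B $ 3 = \<kappa> * (m0 + m2)"
    using s by (simp add: \<kappa>_def)
  have R: "e_radicand B = \<kappa>\<^sup>2 * ((m0 + m2) * (m0 * m2 - m1\<^sup>2)) + (B $ 2)\<^sup>2 * m2 + (B $ 1)\<^sup>2 * m0 - 2 * (B $ 1) * (B $ 2) * m1"
    unfolding e_radicand_def m[symmetric] k using s by (simp add: power2_eq_square)
  let ?w = "\<lambda>y::real^2. B $ 1 * y $ 2 - B $ 2 * y $ 1"
  have cw: "continuous_on UNIV ?w"
    by (intro continuous_intros)
  have "base_integral (\<lambda>y. potential B d (lift y) $ 3) = base_integral (\<lambda>y. ?w y + (- d))"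
    unfolding potential_lift_nth_3 by simp
  then show "base_integral (\<lambda>y. potential B d (lift y) $ 3) = 0"
    by (simp only: base_integral_add[OF cw continuous_on_const] base_integral_const d[symmetric])
  have n: "(norm (potential B d (lift y)))\<^sup>2 =
      ((\<kappa>\<^sup>2 * (m1\<^sup>2 + m0\<^sup>2) + (B $ 2)\<^sup>2) * (y $ 1)\<^sup>2 + (- 2 * \<kappa>\<^sup>2 * m1 * (m0 + m2) - 2 * B $ 1 * B $ 2) * (y $ 1 * y $ 2)
       + (\<kappa>\<^sup>2 * (m2\<^sup>2 + m1\<^sup>2) + (B $ 1)\<^sup>2) * (y $ 2)\<^sup>2) + ((- 2 * d) * ?w y + d\<^sup>2)" for d y
  proof -
    have "(norm (potential B d (lift y)))\<^sup>2 = (potential B d (lift y) $ 1)\<^sup>2 + (potential B d (lift y) $ 2)\<^sup>2 + (potential B d (lift y) $ 3)\<^sup>2"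
      by (simp add: norm_vec_def L2_set_def sum_3 sum_nonneg)
    also have "\<dots> = (\<kappa> * (m1 * y $ 1 - m2 * y $ 2))\<^sup>2 + (\<kappa> * (m0 * y $ 1 - m1 * y $ 2))\<^sup>2 + (?w y - d)\<^sup>2"
      by (simp add: optimal_potential_def lift_def \<kappa>_def m)
    finally show ?thesis by algebra
  qed
  have c1: "continuous_on UNIV (\<lambda>y::real^2. \<alpha> * (y $ 1)\<^sup>2 + \<beta> * (y $ 1 * y $ 2) + \<gamma> * (y $ 2)\<^sup>2)" for \<alpha> \<beta> \<gamma>
    by (intro continuous_intros)
  have c2: "continuous_on UNIV (\<lambda>y::real^2. (- 2 * d) * ?w y)" for d
    by (intro continuous_intros)
  \<comment> \<open>Here \<open>d'\<close> is free while \<open>d\<close> remains the mean of w; the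
    values 0 and d of \<open>d'\<close> give the two energies.\<close>
  have I: "base_integral (\<lambda>y. (norm (potential B d' (lift y)))\<^sup>2) = e_radicand B * ?V - 2 * d' * (d * ?V) + d'\<^sup>2 * ?V" for d'
    unfolding n
    unfolding base_integral_add[OF c1 continuous_on_add[OF c2 continuous_on_const]] base_integral_quadratic
      base_integral_add[OF c2 continuous_on_const] base_integral_cmult base_integral_const d[symmetric]
    unfolding R m[symmetric] by algebra
  show "base_integral (\<lambda>y. (norm (potential B 0 (lift y)))\<^sup>2) = e_radicand B * ?V"
    unfolding I by simp
  show "base_integral (\<lambda>y. (norm (potential B d (lift y)))\<^sup>2) = (e_radicand B - d\<^sup>2) * ?V"
    unfolding I by algebra
qed

text \<open>The radicand is the mean of |a(y, 1)|^2 for the potential with d = 0. If it is zero, the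
  potential vanishes on the open base, so its coefficients vanish; positive moments then force all
  of B to be zero.\<close>

lemma e_radicand_nonneg: "e_radicand B \<ge> 0"
  and e_radicand_pos: "B \<noteq> 0 \<Longrightarrow> e_radicand B > 0"
proof -
  note V = measure_lborel_open_pos[OF \<omega>(2,3,1)]
  define d where "d = base_integral (\<lambda>y. B $ 1 * y $ 2 - B $ 2 * y $ 1) / measure lborel \<omega>"
  have "d * measure lborel \<omega> = base_integral (\<lambda>y. B $ 1 * y $ 2 - B $ 2 * y $ 1)"
    using V by (simp add: d_def)
  note E = potential_energy(2)[OF this]
  have "base_integral (\<lambda>y. (norm (potential B 0 (lift y)))\<^sup>2) \<ge> 0"
    unfolding base_integral_def by (rule integral_nonneg_AE) simp
  then show nn: "e_radicand B \<ge> 0"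
    unfolding E using V by (simp add: zero_le_mult_iff)
  show "e_radicand B > 0" if "B \<noteq> 0"
  proof (rule ccontr)
    assume "\<not> e_radicand B > 0"
    then have "(LINT y|lborel. indicator \<omega> y * (norm (potential B 0 (lift y)))\<^sup>2) = 0"
      using E nn unfolding base_integral_def by simp
    moreover have "continuous_on UNIV (\<lambda>y. (norm (potential B 0 (lift y)))\<^sup>2)"
      by (intro continuous_intros continuous_potential_lift)
    ultimately have "(norm (potential B 0 (lift y)))\<^sup>2 = 0" if "y \<in> \<omega>" for y
      by (intro continuous_integral_eq_0[where f = "\<lambda>y. (norm (potential B 0 (lift y)))\<^sup>2", OF \<omega>(2,3) _ _ _ that] zero_le_power2)
    then have z: "potential B 0 (lift y) = 0" if "y \<in> \<omega>" for y
      using that by simp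
    define \<kappa> where "\<kappa> = B $ 3 / (moment \<omega> 0 + moment \<omega> 2)"
    have z1: "(\<kappa> * moment \<omega> 1) * y $ 1 + (- (\<kappa> * moment \<omega> 2)) * y $ 2 = 0"
      and z3: "(- B $ 2) * y $ 1 + B $ 1 * y $ 2 = 0" if "y \<in> \<omega>" for y
      using arg_cong[OF z[OF that], of "\<lambda>v. v $ 1"] arg_cong[OF z[OF that], of "\<lambda>v. v $ 3"]
      by (simp_all add: optimal_potential_def lift_def \<kappa>_def[symmetric] right_diff_distrib mult.assoc)
    note linear_form_zero_on_open(2)[OF \<omega>(2,1) z1] linear_form_zero_on_open[OF \<omega>(2,1) z3]
    then have "B = 0"
      using moment_pos by (auto simp: vec_eq_iff forall_3 \<kappa>_def)
    then show False using that by simp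
  qed
qed

text \<open>Choosing d as the mean of the third component meets the mean condition, and the energy
  becomes the radicand minus d^2, still at most c^2. Leaving c free above the square root of the
  radicand covers the case of zero field.\<close>

lemma rayleigh_quotient_le_of_radicand_le:
  assumes A: "linear A" "\<And>x. curl A x = B" and n: "n \<ge> 1" and c: "c > 0" "e_radicand B \<le> c\<^sup>2"
  shows "rayleigh_quotient n A (cone_over \<omega>) \<le> ereal ((4 * real n - 1) * c)"
proof -
  note V = measure_lborel_open_pos[OF \<omega>(2,3,1)]
  define d where "d = base_integral (\<lambda>y. B $ 1 * y $ 2 - B $ 2 * y $ 1) / measure lborel \<omega>"
  have d: "d * measure lborel \<omega> = base_integral (\<lambda>y. B $ 1 * y $ 2 - B $ 2 * y $ 1)"
    using V by (simp add: d_def)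
  have energy: "(e_radicand B - d\<^sup>2) * measure lborel \<omega> \<le> c\<^sup>2 * measure lborel \<omega>"
    using c(2) V by (intro mult_right_mono) (auto intro: order_trans[of _ "e_radicand B"])
  have "moment \<omega> 0 + moment \<omega> 2 \<noteq> 0"
    using moment_pos by linarith
  then interpret cone_trial \<omega> "potential B d" A c
    by (intro cone_trial.intro \<omega> A c(1) linear_optimal_potential optimal_potential_symmetric[OF A])
  show ?thesis
    by (rule rayleigh_quotient_le[OF _ _ n])
      (use potential_energy(1,3)[OF d] energy in \<open>simp_all add: base_integral_def\<close>)
qed

end

theorem theorem1p2:
  fixes \<omega> :: "(real^2) set" and B :: "real^3" and A :: "real^3 \<Rightarrow> real^3" and n :: nat
  assumes "\<omega> \<noteq> {}" and "open \<omega>" and "bounded \<omega>"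
    and "linear A" and "\<And>x. curl A x = B"
    and "n \<ge> 1"
  shows "rayleigh_quotient n A (cone_over \<omega>) \<le> ereal ((4 * real n - 1) * e_const B \<omega>)
    \<and> (B \<noteq> 0 \<longrightarrow> e_const B \<omega> > 0)"
proof
  note R = e_radicand_nonneg[OF assms(1-3), of B] e_radicand_pos[OF assms(1-3), of B]
  note bound = rayleigh_quotient_le_of_radicand_le[OF assms(1-6)]
  show "B \<noteq> 0 \<longrightarrow> e_const B \<omega> > 0"
    using R(2) by (simp add: e_const_eq[OF assms(1-3)])
  show "rayleigh_quotient n A (cone_over \<omega>) \<le> ereal ((4 * real n - 1) * e_const B \<omega>)"
  proof (rule ereal_le_epsilon2)
    \<comment> \<open>\<open>e_const B \<omega>\<close> vanishes for \<open>B = 0\<close>, but the Gaussian needs a positive \<open>c\<close>.\<close>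
    fix \<epsilon> :: real assume \<epsilon>: "\<epsilon> > 0"
    have n: "4 * real n - 1 > 0" using assms(6) by simp
    define c where "c = e_const B \<omega> + \<epsilon> / (4 * real n - 1)"
    have e: "e_const B \<omega> \<ge> 0" "(e_const B \<omega>)\<^sup>2 = e_radicand \<omega> B"
      using R(1) by (simp_all add: e_const_eq[OF assms(1-3)])
    have c: "c > 0" "e_const B \<omega> \<le> c"
      using e(1) n \<epsilon> by (auto simp: c_def add_nonneg_pos)
    have "e_radicand \<omega> B \<le> c\<^sup>2"
      unfolding e(2)[symmetric] by (rule power_mono[OF c(2) e(1)])
    then have "rayleigh_quotient n A (cone_over \<omega>) \<le> ereal ((4 * real n - 1) * c)"
      by (rule bound[OF c(1)])
    also have "(4 * real n - 1) * c = (4 * real n - 1) * e_const B \<omega> + \<epsilon>"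
      using n by (simp add: c_def distrib_left)
    finally show "rayleigh_quotient n A (cone_over \<omega>) \<le> ereal ((4 * real n - 1) * e_const B \<omega>) + ereal \<epsilon>"
      by simp
  qed
qed

end
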